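(* Let $s\geq 1$ and $n\geq 30(s+1)$ be integers. Then \[ \mathrm{ex}_3(n,\{F_{5},M_{s+1}^{3}\}) = \begin{cases} \binom{n-1}{2}, & \text{if } s=1,2;\\[3pt] s\left\lfloor\frac{(n-s)^{2}}{4}\right\rfloor, & \text{if } s\geq 3.\end{cases} \] Moreover, for $s=1,2$ the full star is the unique $\{F_{5},M_{s+1}^{3}\}$-free 3-graph on $n$ vertices attaining the maximum number of edges (i.e. the extremal 3-graphs on $[n]$ are exactly the full stars $\mathcal{S}_x$, $x\in[n]$), and for $s\geq 3$, $\mathcal{H}_{3}(n,s)$ is, up to isomorphism, the unique $\{F_{5},M_{s+1}^{3}\}$-free 3-graph on $n$ vertices attaining the maximum number of edges.
   Context: A 3-graph $\mathcal{H}$ consists of a vertex set $V(\mathcal{H})$ and a set of edges, each of which is a 3-element subset of $V(\mathcal{H})$. For a family $\mathcal{F}$ of 3-graphs, a 3-graph is $\mathcal{F}$-free if it contains no member of $\mathcal{F}$ as a (not necessarily induced) subgraph; $\mathrm{ex}_3(n,\mathcal{F})$ is the maximum number of edges in an $\mathcal{F}$-free 3-graph on $n$ vertices. The generalized triangle $F_5$ is the 3-graph on the vertex set $\{a,b,c,d,e\}$ (five distinct vertices) with edge set $\{abc, abd, cde\}$. $M_{s+1}^{3}$ denotes the 3-graph consisting of $s+1$ pairwise disjoint 3-element edges (a matching of size $s+1$), so a 3-graph is $M_{s+1}^3$-free if and only if its matching number (the maximum number of pairwise disjoint edges) is at most $s$. For $x\in[n]=\{1,\ldots,n\}$, the full star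 of center $x$ is the 3-graph $\mathcal{S}_x=\{E\in\binom{[n]}{3}: x\in E\}$ on vertex set $[n]$. $\mathcal{H}_{3}(n,s)$ denotes the complete 3-partite 3-graph on $n$ vertices with one partite set of size $s$ and the other two partite sets of sizes $\lfloor\frac{n-s}{2}\rfloor$ and $\lceil\frac{n-s}{2}\rceil$ (its edges are all triples with exactly one vertex in each partite set). *)

theory Defs
  imports Main
begin

type_synonym 'a hypergraph = "'a set \<times> 'a set set"

abbreviation verts :: "'a hypergraph \<Rightarrow> 'a set" where "verts \<equiv> fst"
abbreviation edges :: "'a hypergraph \<Rightarrow> 'a set set" where "edges \<equiv> snd"

definition three_graph :: "'a hypergraph \<Rightarrow> bool" where
  "three_graph H \<longleftrightarrow> finite (verts H) \<and> (\<forall>e\<in>edges H. e \<subseteq> verts H \<and> card e = 3)"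

text \<open>Containment as a not necessarily induced subgraph.\<close>

definition contains :: "'a hypergraph \<Rightarrow> 'b hypergraph \<Rightarrow> bool" where
  "contains H F \<longleftrightarrow>
     (\<exists>f. inj_on f (verts F) \<and> f ` verts F \<subseteq> verts H \<and> (\<forall>e\<in>edges F. f ` e \<in> edges H))"

definition free_of :: "'b hypergraph set \<Rightarrow> 'a hypergraph \<Rightarrow> bool" where
  "free_of \<F> H \<longleftrightarrow> (\<forall>F\<in>\<F>. \<not> contains H F)"

text \<open>Meaningful for hypergraphs whose edges are sets of vertices: \<open>f\<close> is unconstrained outside
  \<open>verts G\<close>.\<close>

definition isomorphic :: "'a hypergraph \<Rightarrow> 'b hypergraph \<Rightarrow> bool" where
  "isomorphic G H \<longleftrightarrow>
     (\<exists>f. bij_betw f (verts G) (verts H) \<and> (\<lambda>e. f ` e) ` edges G = edges H)"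

text \<open>Every finite 3-graph has an isomorphic copy with vertices in \<open>nat\<close>, so ranging over that type
  loses nothing. The set of edge numbers is bounded by \<open>n choose 3\<close>; it is nonempty whenever
  every member of the family has an edge, and only then is \<open>Max\<close> meaningful for all \<open>n\<close>.\<close>

definition ex3 :: "nat \<Rightarrow> 'b hypergraph set \<Rightarrow> nat" where
  "ex3 n \<F> = Max {card (edges H) | H :: nat hypergraph.
                     three_graph H \<and> card (verts H) = n \<and> free_of \<F> H}"

definition extremal :: "nat \<Rightarrow> 'b hypergraph set \<Rightarrow> 'a hypergraph \<Rightarrow> bool" where
  "extremal n \<F> H \<longleftrightarrow>
     three_graph H \<and> card (verts H) = n \<and> free_of \<F> H \<and> card (edges H) = ex3 n \<F>"

text \<open>The vertices \<open>a, b, c, d, e\<close> are \<open>0, 1, 2, 3, 4\<close>.\<close>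

definition F5 :: "nat hypergraph" where
  "F5 = ({0, 1, 2, 3, 4}, {{0, 1, 2}, {0, 1, 3}, {2, 3, 4}})"

definition matching3 :: "nat \<Rightarrow> nat hypergraph" where
  "matching3 t = ({0..<3 * t}, {{3 * i, 3 * i + 1, 3 * i + 2} | i. i < t})"

definition full_star :: "'a set \<Rightarrow> 'a \<Rightarrow> 'a hypergraph" where
  "full_star V x = (V, {e. e \<subseteq> V \<and> card e = 3 \<and> x \<in> e})"

definition complete_3partite :: "'a set \<Rightarrow> 'a set \<Rightarrow> 'a set \<Rightarrow> 'a hypergraph" where
  "complete_3partite A B C = (A \<union> B \<union> C, {{a, b, c} | a b c. a \<in> A \<and> b \<in> B \<and> c \<in> C})"

text \<open>For \<open>s \<le> n\<close> the parts are consecutive intervals of \<open>{1..n}\<close>; the last one has the remaining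
  \<open>(n - s) - (n - s) div 2\<close> elements, which is the ceiling of half of \<open>n - s\<close>.\<close>

definition H3 :: "nat \<Rightarrow> nat \<Rightarrow> nat hypergraph" where
  "H3 n s = complete_3partite {1..s} {s + 1..s + (n - s) div 2} {s + (n - s) div 2 + 1..n}"

end

theory Submission imports Defs Complex_Main begin

text \<open>
  Fix an \<open>F5\<close>-free 3-graph on \<open>n\<close> vertices with matching number at most \<open>s\<close>. The link of a vertex
  \<open>t\<close> is the graph of the pairs that form an edge together with \<open>t\<close>. In terms of
  links, \<open>F5\<close>-freeness says that an edge of the link of \<open>t\<close> has no common neighbour in the
  link of another vertex \<open>t'\<close>, and that the three vertices of an edge have links that are disjoint
  away from that edge.

  Two graphs on \<open>N\<close> vertices such that no edge of one has a common neighbour in the other have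
  together at most \<open>2 * (N\<^sup>2 div 4)\<close> edges, and equality forces both to be the same balanced
  complete bipartite graph (\<open>sum_two_graphs_le\<close>, \<open>sum_two_graphs_eq\<close>): while they have a common
  edge its two ends can be deleted at the right price, and two disjoint graphs have at most
  \<open>N choose 2\<close> edges. So if \<open>m \<ge> 3\<close> vertices form a set \<open>T\<close>, their links outside \<open>T\<close> have on
  average at most \<open>(n - m)\<^sup>2 div 4\<close> edges. Edges with two vertices in \<open>T\<close> have to be excluded as
  well. Such an edge makes two links almost disjoint, and two almost disjoint links of moderate size
  fall short of the bound by a positive fraction of \<open>N\<^sup>2\<close> (\<open>nearly_disjoint_sum_le\<close>), which is more
  than all the edges with two vertices in \<open>T\<close> can make up for; and a link of large size forces the
  others to be small. This is \<open>card_meeting_le_quarter\<close>, the core of the proof.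

  It remains to choose \<open>T\<close>. Take \<open>T\<close> as large as possible such that deleting it lowers the bound on
  the matching number from \<open>s\<close> to \<open>k = s - card T\<close> (\<open>ex_partial_cover\<close>). By maximality, for every
  further vertex \<open>v\<close> there are \<open>k\<close> disjoint remaining edges that miss \<open>v\<close>, and every remaining
  edge at \<open>v\<close> meets them. As the three links of an edge are disjoint, this leaves
  at most \<open>k * n\<close> edges at \<open>v\<close> and \<open>3 * k\<^sup>2 * n\<close> edges altogether, far fewer than the roughly
  \<open>k * n\<^sup>2 / 4\<close> edges that \<open>k\<close> more vertices in \<open>T\<close> would allow. So \<open>card T = s\<close> in an extremal
  3-graph with \<open>s \<ge> 3\<close>, and the equality case of the link bound makes it complete 3-partite.

  For \<open>s \<le> 2\<close> a full star is larger than what this bound allows, because the link of a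
  single vertex can be complete. The cases in which one or two vertices cover all edges are settled
  directly, and otherwise any edge outside the star of a vertex \<open>t\<close> destroys many pairs of the link
  of \<open>t\<close> (\<open>card_less_star_of_intersecting_remainder\<close>).
\<close>

section \<open>Binomial coefficients and quarter squares\<close>

lemma choose_two_real: "real (n choose 2) = real n * (real n - 1) / 2"
proof (cases n)
  case (Suc m)
  have "2 dvd n * (n - 1)" using Suc by simp
  then have "real (n * (n - 1) div 2) = real (n * (n - 1)) / real 2"
    by (rule real_of_nat_div)
  then show ?thesis using Suc by (simp add: choose_two field_simps)
qed simp

lemma quarter_square_step: "(n + 2)\<^sup>2 div 4 = n\<^sup>2 div 4 + n + (1::nat)"
proof -
  have "(n + 2)\<^sup>2 = n\<^sup>2 + (n + 1) * 4" by (simp add: power2_eq_square)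
  then show ?thesis by simp
qed

lemma quarter_square_eq: "n\<^sup>2 div 4 = (n div 2) * (n - n div (2::nat))"
proof (cases "even n")
  case True
  then obtain k where "n = 2 * k" by blast
  then show ?thesis by (simp add: power2_eq_square)
next
  case False
  then obtain k where k: "n = 2 * k + 1" by (metis oddE)
  have "(2 * k + 1)\<^sup>2 = 1 + (k * (k + 1)) * 4" by (simp add: power2_eq_square algebra_simps)
  then show ?thesis using k by simp
qed

lemma quarter_square_ge: "real (n\<^sup>2 div 4) \<ge> ((real n)\<^sup>2 - 1) / 4"
proof (cases "even n")
  case True
  then obtain k where "n = 2 * k" by blast
  then show ?thesis by (simp add: power2_eq_square)
next
  case False
  then obtain k where k: "n = 2 * k + 1" by (metis oddE)
  have "(2 * k + 1)\<^sup>2 = 1 + (k * (k + 1)) * 4" by (simp add: power2_eq_square algebra_simps)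
  then have "n\<^sup>2 div 4 = k * (k + 1)" using k by simp
  then show ?thesis using k by (simp add: power2_eq_square algebra_simps)
qed

lemma quarter_square_le: "real (n\<^sup>2 div 4) \<le> (real n)\<^sup>2 / 4"
proof -
  have "real (n\<^sup>2 div 4) \<le> real (n\<^sup>2) / 4" by linarith
  then show ?thesis by simp
qed

lemma choose_two_le_quarter: "n choose 2 \<le> 2 * (n\<^sup>2 div 4)"
  and choose_two_less_quarter: "n \<ge> 2 \<Longrightarrow> n choose 2 < 2 * (n\<^sup>2 div 4)"
proof -
  have s: "n choose 2 < 2 * (n\<^sup>2 div 4)" if "n \<ge> 2" for n :: nat
  proof (cases "n = 2")
    case True
    then show ?thesis by (simp add: choose_two)
  next
    case False
    then have "real n \<ge> 3" using that by simp
    then have "real (n choose 2) < real (2 * (n\<^sup>2 div 4))"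
      using quarter_square_ge[of n] unfolding choose_two_real
      by (simp add: field_simps power2_eq_square)
    then show ?thesis by linarith
  qed
  show "n \<ge> 2 \<Longrightarrow> n choose 2 < 2 * (n\<^sup>2 div 4)" by (rule s)
  show "n choose 2 \<le> 2 * (n\<^sup>2 div 4)"
  proof (cases "n \<ge> 2")
    case True
    then show ?thesis using s[of n] by simp
  next
    case False
    then have "n = 0 \<or> n = 1" by auto
    then show ?thesis by auto
  qed
qed

text \<open>
  The difference of \<open>a\<close> and \<open>b\<close> has square \<open>(a + b)\<^sup>2 - 4 * (a * b) < 4\<close>.
\<close>

lemma product_eq_quarter_square:
  fixes a b :: nat
  assumes "a * b = (a + b)\<^sup>2 div 4"
  shows "a = (a + b) div 2 \<or> b = (a + b) div 2"
proof -
  have "(a + b)\<^sup>2 < 4 * (a * b) + 4" using assms by linarith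
  then have "int ((a + b)\<^sup>2) < int (4 * (a * b) + 4)" by (simp only: of_nat_less_iff)
  then have "(int a + int b)\<^sup>2 < 4 * (int a * int b) + 4" by simp
  then have "(int a - int b)\<^sup>2 < 2\<^sup>2" by (simp add: power2_eq_square algebra_simps)
  then have "\<bar>int a - int b\<bar>\<^sup>2 < 2\<^sup>2" by simp
  then have "\<bar>int a - int b\<bar> < 2" by (rule power2_less_imp_less) simp
  then show ?thesis by linarith
qed

lemma product_le_quarter_square: "a * b \<le> (a + b)\<^sup>2 div (4::nat)"
proof -
  have "0 \<le> (int a - int b)\<^sup>2" by simp
  then have "4 * (int a * int b) \<le> (int a + int b)\<^sup>2"
    by (simp add: power2_eq_square algebra_simps)
  then have "int (4 * (a * b)) \<le> int ((a + b)\<^sup>2)" by simp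
  then have "4 * (a * b) \<le> (a + b)\<^sup>2" by linarith
  then show ?thesis by linarith
qed

lemma choose_two_minus_one_real: "n \<ge> 1 \<Longrightarrow> real ((n - 1) choose 2) = (real n - 1) * (real n - 2) / 2"
  by (simp add: choose_two_real of_nat_diff)

section \<open>Two graphs without mixed triangles\<close>

definition pairs :: "'a set \<Rightarrow> 'a set set" where
  "pairs U = {p. p \<subseteq> U \<and> card p = 2}"

definition bipairs :: "'a set \<Rightarrow> 'a set \<Rightarrow> 'a set set" where
  "bipairs A B = {{a, b} | a b. a \<in> A \<and> b \<in> B}"

text \<open>
  No edge of \<open>G\<close> has a common neighbour in \<open>G'\<close>. The links of two vertices of an \<open>F5\<close>-free 3-graph
  satisfy this in both directions.
\<close>

definition triangle_free_over :: "'a set set \<Rightarrow> 'a set set \<Rightarrow> bool" where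
  "triangle_free_over G G' \<longleftrightarrow> (\<forall>x y w. {x, y} \<in> G \<longrightarrow> {x, w} \<in> G' \<longrightarrow> {y, w} \<notin> G')"

lemma triangle_free_overD:
  "triangle_free_over G G' \<Longrightarrow> {x, y} \<in> G \<Longrightarrow> {x, w} \<in> G' \<Longrightarrow> {y, w} \<in> G' \<Longrightarrow> False"
  unfolding triangle_free_over_def by blast

lemma triangle_free_over_mono:
  "triangle_free_over G G' \<Longrightarrow> H \<subseteq> G \<Longrightarrow> H' \<subseteq> G' \<Longrightarrow> triangle_free_over H H'"
  unfolding triangle_free_over_def by blast

lemma finite_pairs: "finite U \<Longrightarrow> finite (pairs U)"
  unfolding pairs_def by simp

lemma card_pairs: "finite U \<Longrightarrow> card (pairs U) = card U choose 2"
  unfolding pairs_def by (rule n_subsets)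

lemma pairs_mono: "U \<subseteq> U' \<Longrightarrow> pairs U \<subseteq> pairs U'"
  unfolding pairs_def by auto

lemma in_pairs_iff: "{x, y} \<in> pairs U \<longleftrightarrow> x \<in> U \<and> y \<in> U \<and> x \<noteq> y"
  unfolding pairs_def by (cases "x = y") auto

lemma pairsE:
  assumes "p \<in> pairs U"
  obtains x y where "p = {x, y}" "x \<noteq> y" "x \<in> U" "y \<in> U"
  using assms unfolding pairs_def by (auto simp: card_2_iff)

text \<open>
  The two ends of the deleted edge have disjoint neighbourhoods, so \<open>card U - 1\<close> edges are lost at
  most, and exactly that many only if every other vertex is adjacent to one of the two ends.
\<close>

lemma card_graph_remove_edge:
  assumes U: "finite U" and G: "G \<subseteq> pairs U" and yz: "y \<in> U" "z \<in> U" "y \<noteq> z"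
    and nc: "\<And>w. {y, w} \<in> G \<Longrightarrow> {z, w} \<notin> G"
  shows "card G + 1 \<le> card (G \<inter> pairs (U - {y, z})) + card U"
    and "card G + 1 = card (G \<inter> pairs (U - {y, z})) + card U \<Longrightarrow> w \<in> U - {y, z}
          \<Longrightarrow> {y, w} \<in> G \<or> {z, w} \<in> G"
proof -
  define Y where "Y = {w \<in> U - {y, z}. {y, w} \<in> G}"
  define Z where "Z = {w \<in> U - {y, z}. {z, w} \<in> G}"
  let ?G' = "G \<inter> pairs (U - {y, z})"
  have fin: "finite Y" "finite Z" "finite ?G'"
    using U finite_pairs[OF U] unfolding Y_def Z_def by (auto simp: finite_pairs)
  have sub: "G \<subseteq> ?G' \<union> {{y, z}} \<union> (\<lambda>w. {y, w}) ` Y \<union> (\<lambda>w. {z, w}) ` Z"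
  proof
    fix p assume p: "p \<in> G"
    then have "p \<in> pairs U" using G by blast
    then obtain a b where ab: "p = {a, b}" "a \<noteq> b" "a \<in> U" "b \<in> U" by (rule pairsE)
    show "p \<in> ?G' \<union> {{y, z}} \<union> (\<lambda>w. {y, w}) ` Y \<union> (\<lambda>w. {z, w}) ` Z"
    proof (cases "a \<in> {y, z} \<or> b \<in> {y, z}")
      case False
      then show ?thesis using p ab by (simp add: in_pairs_iff)
    next
      case True
      then obtain u v where uv: "p = {u, v}" "u \<noteq> v" "v \<in> U" "u = y \<or> u = z"
        using ab by (metis empty_iff insert_commute insert_iff)
      show ?thesis
      proof (cases "v \<in> {y, z}")
        case True
        then have "p = {y, z}" using uv by auto
        then show ?thesis by simp
      next
        case False
        then have "v \<in> (if u = y then Y else Z)" "u \<noteq> y \<Longrightarrow> u = z"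
          using uv p unfolding Y_def Z_def by auto
        then show ?thesis using uv by (cases "u = y") auto
      qed
    qed
  qed
  have "card G \<le> card (?G' \<union> {{y, z}} \<union> (\<lambda>w. {y, w}) ` Y \<union> (\<lambda>w. {z, w}) ` Z)"
    using sub fin by (intro card_mono) auto
  also have "\<dots> \<le> card ?G' + 1 + card Y + card Z"
    using card_Un_le[of ?G' "{{y, z}}"]
      card_Un_le[of "?G' \<union> {{y, z}}" "(\<lambda>w. {y, w}) ` Y"]
      card_Un_le[of "?G' \<union> {{y, z}} \<union> (\<lambda>w. {y, w}) ` Y" "(\<lambda>w. {z, w}) ` Z"]
      card_image_le[OF fin(1), of "\<lambda>w. {y, w}"] card_image_le[OF fin(2), of "\<lambda>w. {z, w}"]
    by simp
  also have "card Y + card Z = card (Y \<union> Z)"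
    using fin nc by (subst card_Un_disjoint) (auto simp: Y_def Z_def)
  then have "card ?G' + 1 + card Y + card Z = card ?G' + 1 + card (Y \<union> Z)" by simp
  finally have le: "card G \<le> card ?G' + 1 + card (Y \<union> Z)" .
  have YZ: "Y \<union> Z \<subseteq> U - {y, z}" unfolding Y_def Z_def by auto
  have c2: "card (U - {y, z}) + 2 = card U"
    using U yz card_Diff_subset[of "{y, z}" U] card_mono[of U "{y, z}"] by auto
  have le2: "card (Y \<union> Z) \<le> card (U - {y, z})" using YZ U by (intro card_mono) auto
  show "card G + 1 \<le> card ?G' + card U" using le le2 c2 by linarith
  show "{y, w} \<in> G \<or> {z, w} \<in> G"
    if "card G + 1 = card ?G' + card U" "w \<in> U - {y, z}"
  proof -
    have "card (Y \<union> Z) = card (U - {y, z})" using le le2 c2 that(1) by linarith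
    then have "Y \<union> Z = U - {y, z}" using YZ U by (intro card_subset_eq) auto
    then have "w \<in> Y \<or> w \<in> Z" using that(2) by blast
    then show ?thesis unfolding Y_def Z_def by blast
  qed
qed

lemma bipairs_iff: "{x, y} \<in> bipairs A B \<longleftrightarrow> (x \<in> A \<and> y \<in> B) \<or> (y \<in> A \<and> x \<in> B)"
  unfolding bipairs_def by (auto simp: doubleton_eq_iff)

lemma bipairs_commute: "bipairs A B = bipairs B A"
  unfolding bipairs_def by (auto simp: insert_commute)

lemma card_bipairs:
  assumes "finite A" "finite B" "A \<inter> B = {}"
  shows "card (bipairs A B) = card A * card B"
proof -
  have "bipairs A B = (\<lambda>(a, b). {a, b}) ` (A \<times> B)" unfolding bipairs_def by auto
  moreover have "inj_on (\<lambda>(a, b). {a, b}) (A \<times> B)"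
    using assms(3) by (auto simp: inj_on_def doubleton_eq_iff)
  ultimately show ?thesis by (simp add: card_image card_cartesian_product)
qed

text \<open>
  Deleting the ends of a common edge costs each graph at most \<open>card U - 1\<close> edges, which is the increment
  of the quarter square over two steps. Without a common edge the two graphs share the
  \<open>card U choose 2\<close> pairs.
\<close>

lemma sum_two_graphs_le:
  assumes "finite U" "G1 \<subseteq> pairs U" "G2 \<subseteq> pairs U"
    and "triangle_free_over G1 G2" "triangle_free_over G2 G1"
  shows "card G1 + card G2 \<le> 2 * ((card U)\<^sup>2 div 4)"
  using assms
proof (induction "card U" arbitrary: U G1 G2 rule: less_induct)
  case less
  have fin: "finite G1" "finite G2"
    using less.prems finite_pairs finite_subset by blast+
  show ?case
  proof (cases "G1 \<inter> G2 = {}")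
    case True
    then have "card G1 + card G2 = card (G1 \<union> G2)" using fin by (simp add: card_Un_disjoint)
    also have "\<dots> \<le> card (pairs U)"
      using less.prems by (intro card_mono) (auto simp: finite_pairs)
    also have "\<dots> \<le> 2 * ((card U)\<^sup>2 div 4)"
      using choose_two_le_quarter less.prems by (simp add: card_pairs)
    finally show ?thesis .
  next
    case False
    then obtain p where p: "p \<in> G1" "p \<in> G2" by auto
    then have "p \<in> pairs U" using less.prems(2) by blast
    then obtain y z where "p = {y, z}" "y \<noteq> z" "y \<in> U" "z \<in> U" by (rule pairsE)
    then have yz: "{y, z} \<in> G1" "{y, z} \<in> G2" "y \<noteq> z" "y \<in> U" "z \<in> U"
      using p by simp_all
    let ?U = "U - {y, z}"
    let ?G1 = "G1 \<inter> pairs ?U" and ?G2 = "G2 \<inter> pairs ?U"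
    have c: "card U = card ?U + 2"
      using less.prems(1) yz card_Diff_subset[of "{y, z}" U] card_mono[of U "{y, z}"] by auto
    have "card ?G1 + card ?G2 \<le> 2 * ((card ?U)\<^sup>2 div 4)"
    proof (rule less.hyps)
      show "card ?U < card U" using c by linarith
      show "triangle_free_over ?G1 ?G2" "triangle_free_over ?G2 ?G1"
        by (rule triangle_free_over_mono[OF less.prems(4)] triangle_free_over_mono[OF less.prems(5)];
          blast)+
    qed (use less.prems(1) in auto)
    moreover have "card G1 + 1 \<le> card ?G1 + card U"
      using less.prems yz
      by (intro card_graph_remove_edge(1)) (auto dest: triangle_free_overD)
    moreover have "card G2 + 1 \<le> card ?G2 + card U"
      using less.prems yz
      by (intro card_graph_remove_edge(1)) (auto dest: triangle_free_overD)
    ultimately show ?thesis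
      using quarter_square_step[of "card ?U"] unfolding c by linarith
  qed
qed

text \<open>
  Equality forces a common edge \<open>{y, z}\<close> whose deletion is tight for both graphs, so the neighbourhoods
  of \<open>y\<close> and \<open>z\<close> in either graph partition \<open>U\<close>. No edge of the other graph lies inside one
  of these two parts, as its ends would have the common neighbour \<open>y\<close> or \<open>z\<close>. Hence both graphs are
  bipartite, and the edge count makes them complete and balanced.
\<close>

lemma sum_two_graphs_eq:
  assumes U: "finite U" "card U \<ge> 2" and G: "G1 \<subseteq> pairs U" "G2 \<subseteq> pairs U"
    and tf: "triangle_free_over G1 G2" "triangle_free_over G2 G1"
    and eq: "card G1 + card G2 = 2 * ((card U)\<^sup>2 div 4)"
  obtains A B where "A \<union> B = U" "A \<inter> B = {}" "card A = card U div 2"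
    "G1 = bipairs A B" "G2 = bipairs A B"
proof -
  have fin: "finite G1" "finite G2" using U G finite_pairs finite_subset by blast+
  have "G1 \<inter> G2 \<noteq> {}"
  proof
    assume "G1 \<inter> G2 = {}"
    then have "card G1 + card G2 = card (G1 \<union> G2)" using fin by (simp add: card_Un_disjoint)
    also have "\<dots> \<le> card (pairs U)" using U G by (intro card_mono) (auto simp: finite_pairs)
    also have "\<dots> < 2 * ((card U)\<^sup>2 div 4)"
      using choose_two_less_quarter U by (simp add: card_pairs)
    finally show False using eq by simp
  qed
  then obtain p where p: "p \<in> G1" "p \<in> G2" by auto
  then have "p \<in> pairs U" using G(1) by blast
  then obtain y z where "p = {y, z}" "y \<noteq> z" "y \<in> U" "z \<in> U" by (rule pairsE)
  then have yz: "{y, z} \<in> G1" "{y, z} \<in> G2" "y \<noteq> z" "y \<in> U" "z \<in> U"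
    using p by simp_all
  let ?U = "U - {y, z}"
  let ?G1 = "G1 \<inter> pairs ?U" and ?G2 = "G2 \<inter> pairs ?U"
  have c: "card U = card ?U + 2"
    using U yz card_Diff_subset[of "{y, z}" U] card_mono[of U "{y, z}"] by auto
  have "card ?G1 + card ?G2 \<le> 2 * ((card ?U)\<^sup>2 div 4)"
  proof (rule sum_two_graphs_le)
    show "triangle_free_over ?G1 ?G2" "triangle_free_over ?G2 ?G1"
      by (rule triangle_free_over_mono[OF tf(1)] triangle_free_over_mono[OF tf(2)]; blast)+
  qed (use U in auto)
  moreover have "card G1 + 1 \<le> card ?G1 + card U"
    using U G tf yz
    by (intro card_graph_remove_edge(1)) (auto dest: triangle_free_overD)
  moreover have "card G2 + 1 \<le> card ?G2 + card U"
    using U G tf yz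
    by (intro card_graph_remove_edge(1)) (auto dest: triangle_free_overD)
  ultimately have tight: "card G1 + 1 = card ?G1 + card U" "card G2 + 1 = card ?G2 + card U"
    using quarter_square_step[of "card ?U"] eq unfolding c by linarith+
  have split: "\<exists>A B. A \<union> B = U \<and> A \<inter> B = {} \<and> A \<noteq> {} \<and> B \<noteq> {} \<and> G' \<subseteq> bipairs A B"
    if GG: "G \<subseteq> pairs U" "G' \<subseteq> pairs U" "triangle_free_over G G'" "triangle_free_over G' G"
      "{y, z} \<in> G" "{y, z} \<in> G'" "card G + 1 = card (G \<inter> pairs ?U) + card U" for G G'
  proof -
    define A where "A = {w \<in> U. {y, w} \<in> G}"
    define B where "B = {w \<in> U. {z, w} \<in> G}"
    have nc: "{z, w} \<notin> G" if "{y, w} \<in> G" for w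
      using GG that unfolding triangle_free_over_def by blast
    have 1: "A \<inter> B = {}" using nc unfolding A_def B_def by auto
    have 2: "z \<in> A" "y \<in> B" using yz GG unfolding A_def B_def by (auto simp: insert_commute)
    have "w \<in> A \<union> B" if "w \<in> ?U" for w
      using card_graph_remove_edge(2)[OF U(1) GG(1) yz(4,5,3) nc GG(7) that] that
      unfolding A_def B_def by auto
    then have 3: "A \<union> B = U" using 2 unfolding A_def B_def by auto
    have "G' \<subseteq> bipairs A B"
    proof
      fix p assume p: "p \<in> G'"
      then have "p \<in> pairs U" using GG(2) by blast
      then obtain u v where uv: "p = {u, v}" "u \<noteq> v" "u \<in> U" "v \<in> U" by (rule pairsE)
      have n: "\<not> ({w, u} \<in> G \<and> {w, v} \<in> G)" for w
        using GG(4) p uv unfolding triangle_free_over_def by (metis insert_commute)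
      then have "\<not> (u \<in> A \<and> v \<in> A)" "\<not> (u \<in> B \<and> v \<in> B)"
        using n[of y] n[of z] unfolding A_def B_def by simp_all
      then show "p \<in> bipairs A B" using uv 3 by (auto simp: bipairs_iff)
    qed
    then show ?thesis using 1 2 3 by blast
  qed
  have bip: "card (bipairs A B) \<le> (card U)\<^sup>2 div 4" if "A \<union> B = U" "A \<inter> B = {}" for A B
    using that U product_le_quarter_square[of "card A" "card B"]
    by (metis card_Un_disjoint card_bipairs finite_Un)
  obtain A B where AB: "A \<union> B = U" "A \<inter> B = {}" "A \<noteq> {}" "B \<noteq> {}" "G2 \<subseteq> bipairs A B"
    using split[OF G tf yz(1,2) tight(1)] by blast
  obtain A' B' where AB': "A' \<union> B' = U" "A' \<inter> B' = {}" "G1 \<subseteq> bipairs A' B'"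
    using split[OF G(2,1) tf(2,1) yz(2,1) tight(2)] by blast
  have finA: "finite A" "finite B" "finite A'" "finite B'"
    using AB(1) AB'(1) U(1) by (metis finite_Un)+
  have finb: "finite (bipairs A B)" "finite (bipairs A' B')"
    using finA by (auto simp: bipairs_def finite_image_set2)
  have c2: "card G2 \<le> card (bipairs A B)" "card G1 \<le> card (bipairs A' B')"
    using AB AB' finb by (auto intro: card_mono)
  then have q: "card G2 = card (bipairs A B)" "card (bipairs A B) = (card U)\<^sup>2 div 4"
     "card G1 = card G2"
    using bip[OF AB(1,2)] bip[OF AB'(1,2)] eq by linarith+
  have G2: "G2 = bipairs A B" using q(1) AB finb by (intro card_subset_eq) auto
  have "G1 \<subseteq> bipairs A B"
  proof
    fix p assume p: "p \<in> G1"
    then have "p \<in> pairs U" using G(1) by blast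
    then obtain u v where uv: "p = {u, v}" "u \<noteq> v" "u \<in> U" "v \<in> U" by (rule pairsE)
    obtain a b where ab: "a \<in> A" "b \<in> B" using AB by auto
    have n: "\<not> ({u, w} \<in> G2 \<and> {v, w} \<in> G2)" for w
      using tf p uv unfolding triangle_free_over_def by blast
    show "p \<in> bipairs A B"
      using n[of a] n[of b] ab uv AB unfolding G2 by (auto simp: bipairs_iff)
  qed
  then have G1: "G1 = bipairs A B" using q finb by (intro card_subset_eq) auto
  have cU: "card U = card A + card B" using AB finA by (metis card_Un_disjoint)
  have "card A * card B = (card A + card B)\<^sup>2 div 4"
    using q(2) card_bipairs[OF finA(1,2) AB(2)] cU by simp
  then consider "card A = card U div 2" | "card B = card U div 2"
    using product_eq_quarter_square cU by metis
  then show thesis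
  proof cases
    case 1
    then show ?thesis using that[of A B] AB G1 G2 by simp
  next
    case 2
    then show ?thesis
      using that[of B A] AB G1 G2 by (simp add: bipairs_commute Un_commute Int_commute)
  qed
qed

lemma card_star:
  assumes "finite V" "x \<in> V"
  shows "card {e. e \<subseteq> V \<and> card e = 3 \<and> x \<in> e} = (card V - 1) choose 2"
proof -
  have "bij_betw (insert x) (pairs (V - {x})) {e. e \<subseteq> V \<and> card e = 3 \<and> x \<in> e}"
    unfolding bij_betw_def
  proof
    show "inj_on (insert x) (pairs (V - {x}))"
      by (rule inj_onI) (auto simp: pairs_def insert_ident)
    show "insert x ` pairs (V - {x}) = {e. e \<subseteq> V \<and> card e = 3 \<and> x \<in> e}"
    proof
      show "insert x ` pairs (V - {x}) \<subseteq> {e. e \<subseteq> V \<and> card e = 3 \<and> x \<in> e}"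
      proof
        fix e assume "e \<in> insert x ` pairs (V - {x})"
        then obtain p where p: "e = insert x p" "p \<subseteq> V - {x}" "card p = 2" unfolding pairs_def by auto
        moreover have "finite p" using p(2) assms(1) by (meson finite_Diff finite_subset)
        moreover have "x \<notin> p" using p by auto
        ultimately show "e \<in> {e. e \<subseteq> V \<and> card e = 3 \<and> x \<in> e}" using assms(2) by auto
      qed
      show "{e. e \<subseteq> V \<and> card e = 3 \<and> x \<in> e} \<subseteq> insert x ` pairs (V - {x})"
      proof
        fix e assume e: "e \<in> {e. e \<subseteq> V \<and> card e = 3 \<and> x \<in> e}"
        then have "e - {x} \<in> pairs (V - {x})"
          by (auto simp: pairs_def card_Diff_singleton)
        moreover have "insert x (e - {x}) = e" using e by auto
        ultimately show "e \<in> insert x ` pairs (V - {x})" by (metis imageI)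
      qed
    qed
  qed
  then have "card (pairs (V - {x})) = card {e. e \<subseteq> V \<and> card e = 3 \<and> x \<in> e}"
    by (rule bij_betw_same_card)
  then show ?thesis using assms by (simp add: card_pairs)
qed

lemma sum_over_pairs:
  fixes g :: "'a \<Rightarrow> real"
  assumes "finite T"
  shows "(\<Sum>p\<in>pairs T. sum g p) = (real (card T) - 1) * sum g T"
  using assms
proof (induction T)
  case empty
  then show ?case by (simp add: pairs_def)
next
  case (insert x T)
  have "pairs (insert x T) = pairs T \<union> (\<lambda>y. {x, y}) ` T"
  proof (rule set_eqI)
    fix p
    show "p \<in> pairs (insert x T) \<longleftrightarrow> p \<in> pairs T \<union> (\<lambda>y. {x, y}) ` T"
    proof
      assume "p \<in> pairs (insert x T)"
      then obtain a b where "p = {a, b}" "a \<noteq> b" "a \<in> insert x T" "b \<in> insert x T" by (rule pairsE)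
      then show "p \<in> pairs T \<union> (\<lambda>y. {x, y}) ` T" by (auto simp: in_pairs_iff insert_commute)
    next
      assume "p \<in> pairs T \<union> (\<lambda>y. {x, y}) ` T"
      then show "p \<in> pairs (insert x T)"
        using insert.hyps pairs_mono[of T "insert x T"] by (auto simp: in_pairs_iff)
    qed
  qed
  moreover have "pairs T \<inter> (\<lambda>y. {x, y}) ` T = {}" using insert.hyps by (auto simp: in_pairs_iff)
  ultimately have "(\<Sum>p\<in>pairs (insert x T). sum g p)
      = (\<Sum>p\<in>pairs T. sum g p) + (\<Sum>p\<in>(\<lambda>y. {x, y}) ` T. sum g p)"
    using insert.hyps by (simp add: sum.union_disjoint finite_pairs)
  also have "(\<Sum>p\<in>(\<lambda>y. {x, y}) ` T. sum g p) = (\<Sum>y\<in>T. sum g {x, y})"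
    by (subst sum.reindex) (auto simp: inj_on_def doubleton_eq_iff)
  also have "\<dots> = (\<Sum>y\<in>T. g x + g y)"
  proof (rule sum.cong)
    fix y assume "y \<in> T"
    then have "x \<noteq> y" using insert.hyps by auto
    then show "sum g {x, y} = g x + g y" by simp
  qed simp
  also have "\<dots> = real (card T) * g x + sum g T" by (simp add: sum.distrib)
  finally show ?case using insert by (simp add: algebra_simps)
qed

lemma sum_degrees:
  assumes "finite U" "G \<subseteq> pairs U"
  shows "(\<Sum>w\<in>U. card {v \<in> U. {w, v} \<in> G}) = 2 * card G"
proof -
  have fin: "finite G" using assms finite_pairs finite_subset by blast
  have "card {v \<in> U. {w, v} \<in> G} = card {p \<in> G. w \<in> p}" for w
  proof (rule bij_betw_same_card[of "\<lambda>v. {w, v}"])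
    show "bij_betw (\<lambda>v. {w, v}) {v \<in> U. {w, v} \<in> G} {p \<in> G. w \<in> p}"
      unfolding bij_betw_def
    proof
      show "inj_on (\<lambda>v. {w, v}) {v \<in> U. {w, v} \<in> G}" by (auto simp: inj_on_def doubleton_eq_iff)
      have "p \<in> (\<lambda>v. {w, v}) ` {v \<in> U. {w, v} \<in> G}" if "p \<in> G" "w \<in> p" for p
      proof -
        have "p \<in> pairs U" using that assms(2) by blast
        then obtain x y where "p = {x, y}" "x \<in> U" "y \<in> U" by (rule pairsE)
        then show ?thesis using that by (cases "w = x") (auto simp: insert_commute)
      qed
      then show "(\<lambda>v. {w, v}) ` {v \<in> U. {w, v} \<in> G} = {p \<in> G. w \<in> p}" by auto
    qed
  qed
  then have "(\<Sum>w\<in>U. card {v \<in> U. {w, v} \<in> G}) = (\<Sum>w\<in>U. card {p \<in> G. w \<in> p})" by simp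
  also have "\<dots> = (\<Sum>w\<in>U. \<Sum>p\<in>G. if w \<in> p then 1 else 0)"
    using fin by (intro sum.cong) (auto simp: sum.If_cases Int_def)
  also have "\<dots> = (\<Sum>p\<in>G. \<Sum>w\<in>U. if w \<in> p then 1 else 0)" by (rule sum.swap)
  also have "\<dots> = (\<Sum>p\<in>G. 2)"
  proof (rule sum.cong)
    fix p assume "p \<in> G"
    then have "U \<inter> {w. w \<in> p} = p" "card p = 2" using assms(2) unfolding pairs_def by auto
    then show "(\<Sum>w\<in>U. if w \<in> p then 1 else 0) = (2::nat)"
      using assms(1) by (simp add: sum.If_cases)
  qed simp
  finally show ?thesis by simp
qed

lemma independent_set_card_le:
  assumes "finite U" "G \<subseteq> pairs U" "B \<subseteq> U" "G \<inter> pairs B = {}"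
  shows "card G + (card B choose 2) \<le> card U choose 2"
proof -
  have fin: "finite G" "finite B" using assms finite_pairs finite_subset by blast+
  have "card G + card (pairs B) = card (G \<union> pairs B)"
    using fin assms by (simp add: card_Un_disjoint finite_pairs)
  also have "\<dots> \<le> card (pairs U)"
    using assms pairs_mono[OF assms(3)] by (intro card_mono) (auto simp: finite_pairs)
  finally show ?thesis using assms fin by (simp add: card_pairs)
qed

text \<open>
  Let \<open>B\<close> and \<open>R\<close> be the neighbourhoods of \<open>w\<close> in the two graphs. Neither graph has an edge between
  \<open>B\<close> and \<open>R\<close>, and \<open>G2\<close> has none inside \<open>B\<close>. If \<open>B\<close> is very large then \<open>G2\<close> is too small, as \<open>G1\<close> has
  limited size; if it is not, then \<open>R\<close> has a proportional size too and too many pairs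
  between \<open>B\<close> and \<open>R\<close> are missing.
\<close>

lemma nearly_disjoint_no_large_degree:
  assumes U: "finite U" "card U \<ge> 100" and G: "G1 \<subseteq> pairs U" "G2 \<subseteq> pairs U"
    and tf: "triangle_free_over G1 G2" "triangle_free_over G2 G1"
    and x: "\<And>p. p \<in> G1 \<Longrightarrow> p \<in> G2 \<Longrightarrow> x \<in> p"
    and e1: "real (card G1) < 28/100 * (real (card U))\<^sup>2"
    and e: "real (card G1) + real (card G2) > 46/100 * (real (card U))\<^sup>2"
    and w: "w \<in> U" "w \<noteq> x"
    and d: "card {v \<in> U. {w, v} \<in> G2} \<le> card {v \<in> U. {w, v} \<in> G1}"
      "real (card {v \<in> U. {w, v} \<in> G1}) + real (card {v \<in> U. {w, v} \<in> G2}) \<ge> 9/10 * real (card U)"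
  shows False
proof -
  define B where "B = {v \<in> U. {w, v} \<in> G1}"
  define R where "R = {v \<in> U. {w, v} \<in> G2}"
  define N b r where "N = real (card U)" and "b = real (card B)" and "r = real (card R)"
  have fin: "finite G1" "finite G2" "finite B" "finite R"
    using U G finite_pairs finite_subset unfolding B_def R_def by (blast, blast, auto)
  have BR: "B \<inter> R \<subseteq> {x}" using x w unfolding B_def R_def by fastforce
  have N: "N \<ge> 100" using U unfolding N_def by simp
  have b0: "b + r \<ge> 9/10 * N" "b \<ge> r" "r \<ge> 0"
    using d unfolding b_def r_def N_def B_def R_def by simp_all
  have "G2 \<inter> pairs B = {}"
  proof (rule ccontr)
    assume "G2 \<inter> pairs B \<noteq> {}"
    then obtain p where "p \<in> G2" "p \<in> pairs B" by auto
    from this(2) obtain u v where "p = {u, v}" "u \<in> B" "v \<in> B" by (rule pairsE)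
    with \<open>p \<in> G2\<close> have "{u, v} \<in> G2" "u \<in> B" "v \<in> B" by simp_all
    then have "{u, v} \<in> G2" "{u, w} \<in> G1" "{v, w} \<in> G1"
      unfolding B_def by (auto simp: insert_commute)
    then show False using tf unfolding triangle_free_over_def by blast
  qed
  then have "card G2 + (card B choose 2) \<le> card U choose 2"
    using U G by (intro independent_set_card_le) (auto simp: B_def)
  then have "real (card G2) + real (card B choose 2) \<le> real (card U choose 2)" by linarith
  then have e2: "real (card G2) + b * (b - 1) / 2 \<le> N * (N - 1) / 2"
    unfolding choose_two_real b_def N_def .
  (* Otherwise G2 has at most about 18/100 N^2 edges, and G1 cannot make up for it. *)
  have b1: "b < 8/10 * N"
  proof (rule ccontr)
    assume "\<not> b < 8/10 * N"
    then have "b * (b - 1) \<ge> (8/10 * N) * (8/10 * N - 1)"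
      using N by (intro mult_mono) auto
    moreover have "(8/10 * N) * (8/10 * N - 1) = 64/100 * N\<^sup>2 - 8/10 * N"
      by (simp add: power2_eq_square field_simps)
    ultimately have low: "64/100 * N\<^sup>2 - 8/10 * N \<le> b * (b - 1)" by (simp only:)
    have "2 * c + p \<le> q" if "c + p / 2 \<le> q / 2" for c p q :: real using that by simp
    from this[OF e2] have "2 * real (card G2) + b * (b - 1) \<le> N * (N - 1)" .
    moreover have "N * (N - 1) = N\<^sup>2 - N" by (simp add: power2_eq_square field_simps)
    ultimately have high: "2 * real (card G2) + b * (b - 1) \<le> N\<^sup>2 - N" by (simp only:)
    have "real (card G2) > 18/100 * N\<^sup>2" using e1 e unfolding N_def[symmetric] by simp
    then show False using low high N by linarith
  qed
  let ?X = "(\<lambda>(u, v). {u, v}) ` (B \<times> (R - {x}))"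
  have "inj_on (\<lambda>(u, v). {u, v}) (B \<times> (R - {x}))"
    using BR by (auto simp: inj_on_def doubleton_eq_iff)
  then have cX: "card ?X = card B * card (R - {x})"
    by (simp add: card_image card_cartesian_product)
  have X: "?X \<subseteq> pairs U" using BR unfolding B_def R_def by (auto simp: in_pairs_iff)
  have dX: "(G1 \<union> G2) \<inter> ?X = {}"
  proof (rule ccontr)
    assume "(G1 \<union> G2) \<inter> ?X \<noteq> {}"
    then obtain u v where uv: "{u, v} \<in> G1 \<union> G2" "u \<in> B" "v \<in> R" by auto
    then have *: "{w, u} \<in> G1" "{w, v} \<in> G2" unfolding B_def R_def by auto
    show False
    proof (cases "{u, v} \<in> G1")
      case True
      then have "{w, v} \<in> G2" "{w, u} \<in> G1" "{v, u} \<in> G1" using * by (auto simp: insert_commute)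
      then show False using tf unfolding triangle_free_over_def by blast
    next
      case False
      then have "{w, u} \<in> G1" "{w, v} \<in> G2" "{u, v} \<in> G2" using * uv by auto
      then show False using tf unfolding triangle_free_over_def by blast
    qed
  qed
  have "card (G1 \<union> G2) + card ?X = card ((G1 \<union> G2) \<union> ?X)"
    using dX fin by (subst card_Un_disjoint) auto
  also have "\<dots> \<le> card (pairs U)" using X U G by (intro card_mono) (auto simp: finite_pairs)
  finally have 1: "card (G1 \<union> G2) + card B * card (R - {x}) \<le> card U choose 2"
    using cX U by (simp add: card_pairs)
  have "G1 \<inter> G2 \<subseteq> (\<lambda>v. {x, v}) ` U"
  proof
    fix p assume p: "p \<in> G1 \<inter> G2"
    then have "p \<in> pairs U" using G by blast
    then obtain u v where "p = {u, v}" "u \<in> U" "v \<in> U" by (rule pairsE)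
    moreover have "x \<in> p" using p x by auto
    ultimately show "p \<in> (\<lambda>v. {x, v}) ` U" by auto
  qed
  then have "card (G1 \<inter> G2) \<le> card U"
    using U by (meson card_image_le card_mono finite_imageI le_trans)
  moreover have "card G1 + card G2 = card (G1 \<union> G2) + card (G1 \<inter> G2)"
    by (rule card_Un_Int[OF fin(1,2)])
  ultimately have "card G1 + card G2 + card B * card (R - {x}) \<le> (card U choose 2) + card U"
    using 1 by linarith
  moreover have "card B * (card R - 1) \<le> card B * card (R - {x})"
    using fin by (intro mult_le_mono2) (simp add: diff_card_le_card_Diff card_Diff_singleton_if)
  ultimately have "card G1 + card G2 + card B * (card R - 1) \<le> (card U choose 2) + card U"
    by linarith
  then have "real (card G1 + card G2 + card B * (card R - 1)) \<le> real ((card U choose 2) + card U)"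
    by (simp only: of_nat_le_iff)
  then have 2: "real (card G1) + real (card G2) + b * real (card R - 1) \<le> N * (N - 1) / 2 + N"
    unfolding b_def N_def by (simp add: choose_two_real)
  have "b * (r - 1) \<le> b * real (card R - 1)"
    unfolding b_def r_def by (intro mult_left_mono) auto
  then have "b * (r - 1) \<le> N * (N - 1) / 2 + N - 46/100 * N\<^sup>2"
    using 2 e unfolding N_def[symmetric] by linarith
  moreover have "N * (N - 1) / 2 = N\<^sup>2 / 2 - N / 2" "b * (r - 1) = b * r - b"
    by (simp_all add: power2_eq_square field_simps)
  ultimately have 3: "b * r - b \<le> 4/100 * N\<^sup>2 + N / 2" by linarith
  (* For b between 1/10 N and 8/10 N the product b * (9/10 N - b) is least at the end points. *)
  have "0 \<le> (b - 1/10 * N) * (8/10 * N - b)" using b0 b1 N by (intro mult_nonneg_nonneg) auto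
  moreover have "b * r \<ge> b * (9/10 * N - b)" using b0 by (intro mult_left_mono) auto
  moreover have "(b - 1/10 * N) * (8/10 * N - b) = 9/10 * (b * N) - b\<^sup>2 - 8/100 * N\<^sup>2"
    "b * (9/10 * N - b) = 9/10 * (b * N) - b\<^sup>2"
    by (simp_all add: power2_eq_square field_simps)
  ultimately have "b * r \<ge> 8/100 * N\<^sup>2" by linarith
  then have 4: "8/100 * N\<^sup>2 - 8/10 * N < 4/100 * N\<^sup>2 + N / 2"
    using 3 b1 N by linarith
  have "100 * N \<le> N * N" using N by (intro mult_right_mono) auto
  then show False using 4 N unfolding power2_eq_square by linarith
qed

text \<open>
  Some vertex other than \<open>x\<close> has at least the average total degree in the two graphs, up to the
  small loss incurred by leaving out \<open>x\<close>. The threshold \<open>28/100\<close> is only slightly above the balanced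
  value \<open>1/4\<close>; without it one graph could be complete and the other one empty.
\<close>

lemma nearly_disjoint_sum_le:
  assumes U: "finite U" "card U \<ge> 100" and G: "G1 \<subseteq> pairs U" "G2 \<subseteq> pairs U"
    and tf: "triangle_free_over G1 G2" "triangle_free_over G2 G1"
    and x: "\<And>p. p \<in> G1 \<Longrightarrow> p \<in> G2 \<Longrightarrow> x \<in> p"
    and e1: "real (card G1) < 28/100 * (real (card U))\<^sup>2"
    and e2: "real (card G2) < 28/100 * (real (card U))\<^sup>2"
  shows "real (card G1) + real (card G2) \<le> 46/100 * (real (card U))\<^sup>2"
proof (rule ccontr)
  assume "\<not> ?thesis"
  then have e: "real (card G1) + real (card G2) > 46/100 * (real (card U))\<^sup>2" by simp
  let ?d = "\<lambda>w. real (card {v \<in> U. {w, v} \<in> G1}) + real (card {v \<in> U. {w, v} \<in> G2})"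
  let ?N = "real (card U)"
  (* The average of ?d exceeds 92/100 N, and leaving out x lowers it by at most about 2. *)
  have "\<exists>w\<in>U. w \<noteq> x \<and> ?d w \<ge> 9/10 * ?N"
  proof (rule ccontr)
    assume a: "\<not> ?thesis"
    have d1: "real (card {v \<in> U. {w, v} \<in> G}) \<le> ?N" for w and G :: "'a set set"
      using U by (simp add: card_mono)
    have dle: "?d w \<le> 2 * ?N" for w using d1[of w G1] d1[of w G2] by linarith
    have "(\<Sum>w\<in>U. ?d w) \<le> (\<Sum>w\<in>U. 9/10 * ?N + (if w = x then 2 * ?N else 0))"
    proof (rule sum_mono)
      fix w assume "w \<in> U"
      then show "?d w \<le> 9/10 * ?N + (if w = x then 2 * ?N else 0)"
        using a dle[of w] by (cases "w = x") force+
    qed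
    also have "\<dots> \<le> 9/10 * ?N\<^sup>2 + 2 * ?N"
      using U by (simp add: sum.distrib power2_eq_square)
    finally have 1: "(\<Sum>w\<in>U. ?d w) \<le> 9/10 * ?N\<^sup>2 + 2 * ?N" .
    have "92/100 * ?N\<^sup>2 < 2 * (real (card G1) + real (card G2))" using e by simp
    also have "\<dots> = real (\<Sum>w\<in>U. card {v \<in> U. {w, v} \<in> G1})
        + real (\<Sum>w\<in>U. card {v \<in> U. {w, v} \<in> G2})"
      using sum_degrees[OF U(1)] G by simp
    also have "\<dots> = (\<Sum>w\<in>U. ?d w)" by (simp add: sum.distrib)
    also note 1
    finally have "92/100 * ?N\<^sup>2 < 9/10 * ?N\<^sup>2 + 2 * ?N" .
    moreover have "100 * ?N \<le> ?N * ?N" using U by (intro mult_right_mono) auto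
    ultimately show False using U unfolding power2_eq_square by linarith
  qed
  then obtain w where w: "w \<in> U" "w \<noteq> x" "?d w \<ge> 9/10 * ?N" by blast
  have e': "real (card G2) + real (card G1) > 46/100 * ?N\<^sup>2" using e by simp
  show False
  proof (cases "card {v \<in> U. {w, v} \<in> G2} \<le> card {v \<in> U. {w, v} \<in> G1}")
    case True
    show False by (rule nearly_disjoint_no_large_degree[OF U G tf x e1 e w(1,2) True w(3)])
  next
    case False
    then have d: "card {v \<in> U. {w, v} \<in> G1} \<le> card {v \<in> U. {w, v} \<in> G2}" by simp
    have "real (card {v \<in> U. {w, v} \<in> G2}) + real (card {v \<in> U. {w, v} \<in> G1}) \<ge> 9/10 * ?N"
      using w(3) by linarith
    from nearly_disjoint_no_large_degree[OF U G(2,1) tf(2,1) x e2 e' w(1,2) d this]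
    show False by blast
  qed
qed

section \<open>Links, degrees and matchings in $F_5$-free 3-graphs\<close>

definition matching_le :: "'a set set \<Rightarrow> nat \<Rightarrow> bool" where
  "matching_le E k \<longleftrightarrow> (\<forall>M \<subseteq> E. pairwise disjnt M \<longrightarrow> card M \<le> k)"

lemma matching_leD: "matching_le E k \<Longrightarrow> M \<subseteq> E \<Longrightarrow> pairwise disjnt M \<Longrightarrow> card M \<le> k"
  unfolding matching_le_def by blast

lemma distinct_of_card_triple: "card {a, b, c} = 3 \<Longrightarrow> a \<noteq> b \<and> a \<noteq> c \<and> b \<noteq> c"
  by (auto simp: card_insert_if split: if_splits)

locale F5_free_graph =
  fixes V :: "'a set" and E :: "'a set set"
  assumes finite_V: "finite V"
    and edge_subset: "e \<in> E \<Longrightarrow> e \<subseteq> V"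
    and card_edge: "e \<in> E \<Longrightarrow> card e = 3"
    and F5_free: "distinct [a, b, c, d, w] \<Longrightarrow> {a, b, c} \<in> E \<Longrightarrow> {a, b, d} \<in> E \<Longrightarrow> {c, d, w} \<notin> E"
begin

lemma finite_E: "finite E"
  using finite_V edge_subset by (meson Pow_iff finite_Pow_iff finite_subset subsetI)

lemma finite_edge: "e \<in> E \<Longrightarrow> finite e"
  using card_edge by (metis card.infinite zero_neq_numeral)

definition avoiding :: "'a set \<Rightarrow> 'a set set" where
  "avoiding T = {e \<in> E. e \<inter> T = {}}"

definition meeting :: "'a set \<Rightarrow> 'a set set" where
  "meeting T = {e \<in> E. e \<inter> T \<noteq> {}}"

definition link :: "'a set \<Rightarrow> 'a \<Rightarrow> 'a set set" where
  "link U t = {p \<in> pairs U. insert t p \<in> E}"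

lemma link_subset: "link U t \<subseteq> pairs U"
  unfolding link_def by auto

lemma finite_link: "U \<subseteq> V \<Longrightarrow> finite (link U t)"
  using finite_V link_subset finite_pairs by (metis finite_subset)

lemma card_E_split: "card E = card (avoiding T) + card (meeting T)"
proof -
  have "E = avoiding T \<union> meeting T" "avoiding T \<inter> meeting T = {}"
    unfolding avoiding_def meeting_def by auto
  then show ?thesis using finite_E by (metis card_Un_disjoint finite_Un)
qed

lemma link_triangle_free:
  assumes "s \<notin> U" "t \<notin> U" "s \<noteq> t"
  shows "triangle_free_over (link U s) (link U t)"
  unfolding triangle_free_over_def
proof (intro allI impI notI)
  fix x y w
  assume a: "{x, y} \<in> link U s" "{x, w} \<in> link U t" "{y, w} \<in> link U t"
  then have "distinct [t, w, x, y, s]" using assms by (auto simp: link_def in_pairs_iff)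
  moreover have "{t, w, x} \<in> E" "{t, w, y} \<in> E" "{x, y, s} \<in> E"
    using a by (auto simp: link_def insert_commute)
  ultimately show False using F5_free by blast
qed

text \<open>
  Two elements of \<open>X\<close> complete \<open>{u, v}\<close> to edges, hence no edge contains both of them and a vertex
  \<open>t\<close> outside \<open>{u, v}\<close>.
\<close>

lemma link_of_codegree_set:
  assumes "X \<subseteq> {x. {u, v, x} \<in> E}" "u \<noteq> v" "t \<notin> {u, v}"
  shows "link U t \<inter> pairs X = {}"
proof (rule ccontr)
  assume "link U t \<inter> pairs X \<noteq> {}"
  then obtain p where p: "p \<in> link U t" "p \<in> pairs X" by auto
  from p(2) obtain x y where xy: "p = {x, y}" "x \<noteq> y" "x \<in> X" "y \<in> X" by (rule pairsE)
  have e: "{u, v, x} \<in> E" "{u, v, y} \<in> E" "{x, y, t} \<in> E"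
  proof -
    show "{u, v, x} \<in> E" "{u, v, y} \<in> E" using xy(3,4) assms(1) by blast+
    have "{x, y, t} = insert t p" using xy(1) by blast
    then show "{x, y, t} \<in> E" using p(1) unfolding link_def by simp
  qed
  then have "distinct [u, v, x, y, t]"
    using distinct_of_card_triple[OF card_edge[OF e(1)]] distinct_of_card_triple[OF card_edge[OF e(2)]]
      distinct_of_card_triple[OF card_edge[OF e(3)]] xy assms(3) by auto
  then show False using e F5_free by blast
qed

text \<open>
  If \<open>{s, t, x}\<close> is an edge, then a pair in both links that avoids \<open>x\<close> gives a copy of \<open>F5\<close>. So the two
  links are almost disjoint.
\<close>

lemma covered_pair_common_link:
  assumes "s \<in> T" "t \<in> T" "s \<noteq> t" "e \<in> E" "{s, t} \<subseteq> e"
  obtains x where "\<And>p. p \<in> link (V - T) s \<Longrightarrow> p \<in> link (V - T) t \<Longrightarrow> x \<in> p"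
proof -
  have "card (e - {s, t}) = 1"
    using assms card_edge[OF assms(4)] by (simp add: card_Diff_subset)
  then obtain x where "e - {s, t} = {x}" by (auto simp: card_1_singleton_iff)
  then have x: "e = {s, t, x}" "x \<noteq> s" "x \<noteq> t" using assms(5) by auto
  have "x \<in> p" if p: "p \<in> link (V - T) s" "p \<in> link (V - T) t" for p
  proof (rule ccontr)
    assume nx: "x \<notin> p"
    have "p \<in> pairs (V - T)" using p link_subset by blast
    then obtain y z where yz: "p = {y, z}" "y \<noteq> z" "y \<in> V - T" "z \<in> V - T" by (rule pairsE)
    then have "distinct [y, z, s, t, x]" using assms x nx by auto
    moreover have "{y, z, s} \<in> E" "{y, z, t} \<in> E" "{s, t, x} \<in> E"
      using p yz x assms(4) by (auto simp: link_def insert_commute)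
    ultimately show False using F5_free by blast
  qed
  then show thesis by (rule that)
qed

lemma card_pair_codegree: "card {e \<in> E. {s, t} \<subseteq> e} \<le> card V" if "s \<noteq> t"
proof -
  have "{e \<in> E. {s, t} \<subseteq> e} \<subseteq> (\<lambda>x. {s, t, x}) ` V"
  proof
    fix e assume e: "e \<in> {e \<in> E. {s, t} \<subseteq> e}"
    have "card (e - {s, t}) = 1"
      using e that card_edge[of e] by (simp add: card_Diff_subset)
    then obtain x where "e - {s, t} = {x}" by (auto simp: card_1_singleton_iff)
    then have "e = {s, t, x}" "x \<in> e" using e by auto
    then show "e \<in> (\<lambda>x. {s, t, x}) ` V" using e edge_subset by auto
  qed
  then show ?thesis using finite_V by (meson card_image_le card_mono finite_imageI le_trans)
qed

text \<open>
  For each \<open>w\<close> outside \<open>f\<close> and \<open>v\<close> at most one vertex of \<open>f\<close> forms an edge with \<open>v\<close> and \<open>w\<close>, since two of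
  them would form an \<open>F5\<close> with \<open>f\<close>. There are \<open>card V - 4\<close> such \<open>w\<close>, and three further
  edges can consist of \<open>v\<close> and two vertices of \<open>f\<close>.
\<close>

lemma card_meeting_edge_at_vertex:
  assumes f: "f \<in> E" and v: "v \<in> V" "v \<notin> f"
  shows "card {e \<in> E. v \<in> e \<and> e \<inter> f \<noteq> {}} + 1 \<le> card V"
proof -
  define W where "W = V - insert v f"
  have fin: "finite W" using finite_V unfolding W_def by simp
  have finf: "finite f" by (rule finite_edge[OF f])
  have cW: "card W + 4 = card V"
    using f v finite_V edge_subset[OF f] card_edge[OF f] card_mono[of V "insert v f"]
    unfolding W_def by (auto simp: card_Diff_subset finf)
  define S where "S w = {e \<in> E. v \<in> e \<and> w \<in> e \<and> e \<inter> f \<noteq> {}}" for w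
  have S1: "card (S w) \<le> 1" if w: "w \<in> W" for w
  proof -
    have fS: "finite (S w)" using finite_E unfolding S_def by auto
    have form: "\<exists>a\<in>f. e = {v, w, a}" if e: "e \<in> S w" for e
    proof -
      obtain a where a: "a \<in> e" "a \<in> f" using e unfolding S_def by auto
      have "v \<noteq> w" "v \<noteq> a" "w \<noteq> a" using a w v unfolding W_def by auto
      then have "card {v, w, a} = 3" by simp
      moreover have "{v, w, a} \<subseteq> e" "card e = 3" "finite e"
        using e a card_edge finite_edge unfolding S_def by auto
      ultimately have "{v, w, a} = e" by (metis card_subset_eq)
      then show ?thesis using a by auto
    qed
    have "e = e'" if e: "e \<in> S w" "e' \<in> S w" for e e'
    proof (rule ccontr)
      assume ne: "e \<noteq> e'"
      obtain a a' where a: "a \<in> f" "a' \<in> f" "e = {v, w, a}" "e' = {v, w, a'}"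
        using form e by blast
      have aa: "a \<noteq> a'" using ne a by auto
      have "card (f - {a, a'}) = 1" using a aa card_edge[OF f] by (simp add: card_Diff_subset)
      then obtain c where "f - {a, a'} = {c}" by (auto simp: card_1_singleton_iff)
      then have c: "f = {a, a', c}" "c \<noteq> a" "c \<noteq> a'" using a by auto
      then have "distinct [v, w, a, a', c]" using v w aa unfolding W_def by auto
      moreover have "{v, w, a} \<in> E" "{v, w, a'} \<in> E" "{a, a', c} \<in> E"
        using e a c f unfolding S_def by auto
      ultimately show False using F5_free by blast
    qed
    then show ?thesis using fS by (simp add: card_le_Suc0_iff_eq)
  qed
  have "{e \<in> E. v \<in> e \<and> e \<inter> f \<noteq> {}} \<subseteq> (\<Union>w\<in>W. S w) \<union> (\<lambda>u. insert v (f - {u})) ` f"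
  proof
    fix e assume e: "e \<in> {e \<in> E. v \<in> e \<and> e \<inter> f \<noteq> {}}"
    show "e \<in> (\<Union>w\<in>W. S w) \<union> (\<lambda>u. insert v (f - {u})) ` f"
    proof (cases "e \<subseteq> insert v f")
      case False
      then obtain w where "w \<in> e" "w \<in> W" using e edge_subset unfolding W_def by blast
      then show ?thesis using e unfolding S_def by auto
    next
      case True
      have "card (e - {v}) = 2" using e card_edge finite_edge by (simp add: card_Diff_singleton)
      moreover have sub: "e - {v} \<subseteq> f" using True by auto
      ultimately have "card (f - (e - {v})) = 1"
        using card_Diff_subset[OF finite_subset[OF sub finf] sub] card_edge[OF f] by linarith
      then obtain u where "f - (e - {v}) = {u}" by (auto simp: card_1_singleton_iff)
      then have "u \<in> f" "e - {v} = f - {u}" using sub by auto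
      then have "e = insert v (f - {u})" using e by auto
      then show ?thesis using \<open>u \<in> f\<close> by auto
    qed
  qed
  then have "card {e \<in> E. v \<in> e \<and> e \<inter> f \<noteq> {}}
      \<le> card ((\<Union>w\<in>W. S w) \<union> (\<lambda>u. insert v (f - {u})) ` f)"
    using fin finf finite_E by (intro card_mono) (auto simp: S_def)
  also have "\<dots> \<le> card (\<Union>w\<in>W. S w) + card ((\<lambda>u. insert v (f - {u})) ` f)"
    by (rule card_Un_le)
  also have "card (\<Union>w\<in>W. S w) \<le> (\<Sum>w\<in>W. card (S w))"
    using fin by (rule card_UN_le)
  also have "\<dots> \<le> card W" using sum_mono[of W "\<lambda>w. card (S w)" "\<lambda>_. 1"] S1 by simp
  also have "card ((\<lambda>u. insert v (f - {u})) ` f) \<le> 3"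
    using card_image_le[OF finf] card_edge[OF f] by metis
  finally show ?thesis using cW by linarith
qed

text \<open>
  Every edge at \<open>v\<close> meets an edge of the maximum matching \<open>M\<close>, and by
  \<open>card_meeting_edge_at_vertex\<close> each edge of \<open>M\<close> is met by fewer than \<open>card V\<close> edges at \<open>v\<close>.
\<close>

lemma degree_le_of_avoiding_matching:
  assumes E': "E' \<subseteq> E" and M: "M \<subseteq> E'" "pairwise disjnt M" and max: "matching_le E' (card M)"
    and v: "v \<in> V" "v \<notin> \<Union>M"
  shows "card {e \<in> E'. v \<in> e} \<le> card M * card V"
proof -
  have fM: "finite M" using M E' finite_E finite_subset by metis
  have "{e \<in> E'. v \<in> e} \<subseteq> (\<Union>f\<in>M. {e \<in> E. v \<in> e \<and> e \<inter> f \<noteq> {}})"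
  proof (rule subsetI, rule ccontr)
    fix e
    assume e: "e \<in> {e \<in> E'. v \<in> e}"
      and n: "e \<notin> (\<Union>f\<in>M. {e \<in> E. v \<in> e \<and> e \<inter> f \<noteq> {}})"
    then have d: "\<forall>f\<in>M. disjnt e f" using E' unfolding disjnt_def by blast
    then have "pairwise disjnt (insert e M)"
      using M(2) by (auto simp: pairwise_insert disjnt_sym)
    then have "card (insert e M) \<le> card M"
      using max e M(1) by (intro matching_leD) auto
    moreover have "e \<notin> M" using e v by auto
    ultimately show False using fM by simp
  qed
  then have "card {e \<in> E'. v \<in> e} \<le> card (\<Union>f\<in>M. {e \<in> E. v \<in> e \<and> e \<inter> f \<noteq> {}})"
    using fM finite_E by (intro card_mono) auto
  also have "\<dots> \<le> (\<Sum>f\<in>M. card {e \<in> E. v \<in> e \<and> e \<inter> f \<noteq> {}})"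
    using fM by (rule card_UN_le)
  also have "\<dots> \<le> (\<Sum>f\<in>M. card V)"
  proof (rule sum_mono)
    fix f assume "f \<in> M"
    then have "f \<in> E" "v \<notin> f" using M E' v by auto
    then show "card {e \<in> E. v \<in> e \<and> e \<inter> f \<noteq> {}} \<le> card V"
      using card_meeting_edge_at_vertex[of f v] v by linarith
  qed
  finally show ?thesis by simp
qed

text \<open>
  The at most \<open>3 * k\<close> vertices of a maximum matching meet every edge.
\<close>

lemma card_le_of_matching_le:
  assumes E': "E' \<subseteq> E" and k: "matching_le E' k"
    and D: "\<And>v. v \<in> V \<Longrightarrow> card {e \<in> E'. v \<in> e} \<le> D"
  shows "card E' \<le> 3 * k * D"
proof -
  have finE': "finite E'" using E' finite_E finite_subset by metis
  let ?P = "\<lambda>M. M \<subseteq> E' \<and> pairwise disjnt M"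
  have "\<exists>M. ?P M \<and> (\<forall>M'. ?P M' \<longrightarrow> card M' \<le> card M)"
    using k by (intro ex_has_greatest_nat[of ?P "{}" card "Suc k"]) (auto simp: matching_le_def le_imp_less_Suc)
  then obtain M where M: "M \<subseteq> E'" "pairwise disjnt M"
    and max: "\<And>M'. M' \<subseteq> E' \<Longrightarrow> pairwise disjnt M' \<Longrightarrow> card M' \<le> card M" by blast
  have fM: "finite M" using M finE' finite_subset by metis
  have ck: "card M \<le> k" using k M by (rule matching_leD)
  have sub: "\<Union>M \<subseteq> V" using M E' edge_subset by blast
  have finU: "finite (\<Union>M)" using sub finite_V finite_subset by metis
  have "card (\<Union>M) \<le> (\<Sum>f\<in>M. card f)" using card_UN_le[OF fM, of "\<lambda>f. f"] by simp
  also have "\<dots> = (\<Sum>f\<in>M. 3)" using M E' card_edge by (intro sum.cong) auto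
  finally have cU: "card (\<Union>M) \<le> 3 * k" using ck by simp
  have "E' \<subseteq> (\<Union>v\<in>\<Union>M. {e \<in> E'. v \<in> e})"
  proof (rule subsetI, rule ccontr)
    fix e assume e: "e \<in> E'" and n: "e \<notin> (\<Union>v\<in>\<Union>M. {e \<in> E'. v \<in> e})"
    then have d: "\<forall>f\<in>M. disjnt e f" unfolding disjnt_def by blast
    then have "pairwise disjnt (insert e M)"
      using M(2) by (auto simp: pairwise_insert disjnt_sym)
    then have "card (insert e M) \<le> card M" using max e M(1) by auto
    moreover have "e \<noteq> {}" using e E' card_edge by fastforce
    then have "e \<notin> M" using n e by auto
    ultimately show False using fM by simp
  qed
  then have "card E' \<le> card (\<Union>v\<in>\<Union>M. {e \<in> E'. v \<in> e})"
    using finE' finU by (intro card_mono finite_UN_I) auto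
  also have "\<dots> \<le> (\<Sum>v\<in>\<Union>M. card {e \<in> E'. v \<in> e})" using finU by (rule card_UN_le)
  also have "\<dots> \<le> (\<Sum>v\<in>\<Union>M. D)" using D sub by (intro sum_mono) auto
  also have "\<dots> = card (\<Union>M) * D" by simp
  also have "\<dots> \<le> 3 * k * D" using cU by (intro mult_right_mono) auto
  finally show ?thesis .
qed

text \<open>
  A largest \<open>T\<close> whose deletion lowers the matching bound by \<open>card T\<close> works: a vertex \<open>v\<close> cannot be
  added to it, hence the edges avoiding both \<open>T\<close> and \<open>v\<close> still contain a matching with as many edges as
  any matching avoiding \<open>T\<close>, and this bounds the degree of \<open>v\<close>.
\<close>

lemma ex_partial_cover:
  assumes s: "matching_le E s"
  obtains T where "T \<subseteq> V" "card T \<le> s" "matching_le (avoiding T) (s - card T)"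
    "card (avoiding T) \<le> 3 * (s - card T)\<^sup>2 * card V"
proof -
  define good where
    "good T \<longleftrightarrow> T \<subseteq> V \<and> card T \<le> s \<and> matching_le (avoiding T) (s - card T)" for T
  have "good {}" using s unfolding good_def avoiding_def by simp
  then have "\<exists>T. good T \<and> (\<forall>T'. good T' \<longrightarrow> card T' \<le> card T)"
    by (intro ex_has_greatest_nat[of good "{}" card "Suc s"])
      (auto simp: good_def le_imp_less_Suc)
  then obtain T where T: "good T" and max: "\<And>T'. good T' \<Longrightarrow> card T' \<le> card T" by blast
  let ?k = "s - card T"
  have sub: "avoiding T \<subseteq> E" unfolding avoiding_def by auto
  have finT: "finite T" using T finite_V finite_subset unfolding good_def by metis
  have k: "matching_le (avoiding T) ?k" using T unfolding good_def by blast
  have "card {e \<in> avoiding T. v \<in> e} \<le> ?k * card V" if v: "v \<in> V" for v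
  proof (cases "v \<in> T \<or> ?k = 0")
    case True
    have "{e \<in> avoiding T. v \<in> e} = {}"
    proof (cases "v \<in> T")
      case False
      then have "matching_le (avoiding T) 0" using k True by simp
      then have "e \<notin> avoiding T" for e using matching_leD[of "avoiding T" 0 "{e}"] by auto
      then show ?thesis by auto
    qed (auto simp: avoiding_def)
    then show ?thesis by (simp only: card.empty)
  next
    case False
    have ins: "card (insert v T) = Suc (card T)" using False finT by simp
    have "\<not> good (insert v T)" using max[of "insert v T"] ins by auto
    then have "\<not> matching_le (avoiding (insert v T)) (s - card (insert v T))"
      using T v False ins unfolding good_def by auto
    then obtain M where M: "M \<subseteq> avoiding (insert v T)" "pairwise disjnt M" "card M > ?k - 1"
      unfolding matching_le_def ins by auto
    have M': "M \<subseteq> avoiding T" using M(1) unfolding avoiding_def by auto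
    have "card M \<le> ?k" using k M' M(2) by (rule matching_leD)
    then have cM: "card M = ?k" using M(3) by linarith
    have "v \<notin> \<Union>M" using M(1) unfolding avoiding_def by auto
    then have "card {e \<in> avoiding T. v \<in> e} \<le> card M * card V"
      using degree_le_of_avoiding_matching[OF sub M' M(2)] k v unfolding cM by blast
    then show ?thesis unfolding cM .
  qed
  then have "card (avoiding T) \<le> 3 * ?k * (?k * card V)"
    by (rule card_le_of_matching_le[OF sub k])
  then have "card (avoiding T) \<le> 3 * ?k\<^sup>2 * card V" by (simp add: power2_eq_square mult.assoc)
  then show thesis using that T k unfolding good_def by blast
qed

section \<open>Edges meeting a small vertex set\<close>

definition covered :: "'a set \<Rightarrow> 'a set set" where
  "covered T = {p \<in> pairs T. \<exists>e\<in>E. p \<subseteq> e}"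

lemma meeting_subset:
  "meeting T \<subseteq> (\<Union>t\<in>T. insert t ` link (V - T) t) \<union> (\<Union>p\<in>covered T. {e \<in> E. p \<subseteq> e})"
proof
  fix e assume "e \<in> meeting T"
  then obtain t where t: "t \<in> e" "t \<in> T" "e \<in> E" unfolding meeting_def by auto
  show "e \<in> (\<Union>t\<in>T. insert t ` link (V - T) t) \<union> (\<Union>p\<in>covered T. {e \<in> E. p \<subseteq> e})"
  proof (cases "\<exists>u\<in>e \<inter> T. u \<noteq> t")
    case True
    then obtain u where "u \<in> e" "u \<in> T" "u \<noteq> t" by auto
    then have "{t, u} \<in> covered T" "{t, u} \<subseteq> e"
      using t unfolding covered_def by (auto simp: in_pairs_iff)
    then show ?thesis using t by blast
  next
    case False
    have "card (e - {t}) = 2" using t card_edge finite_edge by (simp add: card_Diff_singleton)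
    moreover have "insert t (e - {t}) = e" using t by auto
    moreover have "e - {t} \<subseteq> V - T" using False edge_subset[OF t(3)] by auto
    ultimately have "e - {t} \<in> link (V - T) t" "insert t (e - {t}) = e"
      using t unfolding link_def pairs_def by auto
    then show ?thesis using t by blast
  qed
qed

lemma card_meeting_le:
  assumes T: "T \<subseteq> V"
  shows "card (meeting T) \<le> (\<Sum>t\<in>T. card (link (V - T) t)) + card (covered T) * card V"
proof -
  have "finite T" using T finite_V by (rule finite_subset)
  then have fin: "finite T" "finite (covered T)" unfolding covered_def by (simp_all add: finite_pairs)
  have fl: "finite (link (V - T) t)" for t by (rule finite_link) auto
  have "card (meeting T)
    \<le> card ((\<Union>t\<in>T. insert t ` link (V - T) t) \<union> (\<Union>p\<in>covered T. {e \<in> E. p \<subseteq> e}))"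
    using fin fl finite_E by (intro card_mono meeting_subset) auto
  also have "\<dots> \<le> card (\<Union>t\<in>T. insert t ` link (V - T) t) + card (\<Union>p\<in>covered T. {e \<in> E. p \<subseteq> e})"
    by (rule card_Un_le)
  also have "card (\<Union>t\<in>T. insert t ` link (V - T) t) \<le> (\<Sum>t\<in>T. card (insert t ` link (V - T) t))"
    using fin(1) by (rule card_UN_le)
  also have "\<dots> \<le> (\<Sum>t\<in>T. card (link (V - T) t))"
    using fl by (intro sum_mono card_image_le)
  also have "card (\<Union>p\<in>covered T. {e \<in> E. p \<subseteq> e}) \<le> (\<Sum>p\<in>covered T. card {e \<in> E. p \<subseteq> e})"
    using fin(2) by (rule card_UN_le)
  also have "\<dots> \<le> (\<Sum>p\<in>covered T. card V)"
  proof (rule sum_mono)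
    fix p assume "p \<in> covered T"
    then have "p \<in> pairs T" unfolding covered_def by simp
    then obtain x y where "p = {x, y}" "x \<noteq> y" by (rule pairsE)
    then show "card {e \<in> E. p \<subseteq> e} \<le> card V" using card_pair_codegree by simp
  qed
  finally show ?thesis by simp
qed

lemma meeting_eq_of_uncovered:
  assumes "covered T = {}"
  shows "meeting T = (\<Union>t\<in>T. insert t ` link (V - T) t)"
proof
  show "meeting T \<subseteq> (\<Union>t\<in>T. insert t ` link (V - T) t)" using meeting_subset[of T] assms by auto
  show "(\<Union>t\<in>T. insert t ` link (V - T) t) \<subseteq> meeting T"
    unfolding meeting_def link_def by auto
qed

lemma sum_two_links_le:
  assumes "T \<subseteq> V" "s \<in> T" "t \<in> T" "s \<noteq> t"
  shows "card (link (V - T) s) + card (link (V - T) t) \<le> 2 * ((card V - card T)\<^sup>2 div 4)"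
proof -
  have "card (V - T) = card V - card T"
    using assms(1) finite_V by (meson card_Diff_subset finite_subset)
  then show ?thesis
    using sum_two_graphs_le[of "V - T" "link (V - T) s" "link (V - T) t"]
      link_triangle_free[of s "V - T" t] link_triangle_free[of t "V - T" s] assms finite_V
    by (simp add: link_subset)
qed

text \<open>
  One link that exceeds the average \<open>q\<close> pushes every other link below \<open>q\<close> by the same amount.
\<close>

lemma sum_links_of_large:
  assumes T: "T \<subseteq> V" "t \<in> T"
  defines "q \<equiv> (card V - card T)\<^sup>2 div 4"
  shows "(\<Sum>s\<in>T. real (card (link (V - T) s)))
    \<le> real (card (link (V - T) t)) + (real (card T) - 1) * (2 * real q - real (card (link (V - T) t)))"
proof -
  let ?e = "\<lambda>s. real (card (link (V - T) s))"
  have fin: "finite T" using T finite_V finite_subset by metis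
  have "(\<Sum>s\<in>T. ?e s) = ?e t + (\<Sum>s\<in>T - {t}. ?e s)" using fin T by (simp add: sum.remove)
  also have "(\<Sum>s\<in>T - {t}. ?e s) \<le> (\<Sum>s\<in>T - {t}. 2 * real q - ?e t)"
  proof (rule sum_mono)
    fix s assume "s \<in> T - {t}"
    then have "card (link (V - T) s) + card (link (V - T) t) \<le> 2 * q"
      using sum_two_links_le[of T s t] T unfolding q_def by auto
    then show "?e s \<le> 2 * real q - ?e t" by linarith
  qed
  also have "\<dots> = (real (card T) - 1) * (2 * real q - ?e t)"
  proof -
    have "card T \<ge> 1" using fin T by (metis One_nat_def Suc_leI card_gt_0_iff empty_iff)
    then show ?thesis using fin T by (simp add: of_nat_diff)
  qed
  finally show ?thesis by simp
qed

text \<open>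
  Let \<open>N = card V - card T\<close>. The dominant link exceeds \<open>N\<^sup>2 / 4\<close> by at least \<open>3/100 * N\<^sup>2\<close>, which by \<open>sum_links_of_large\<close> costs
  \<open>card T - 2\<close> times that amount. The edges with two vertices in \<open>T\<close> are too few to compensate,
  as \<open>card T\<close> is at most about \<open>N / 29\<close>.
\<close>

lemma card_meeting_less_of_dominant:
  assumes T: "T \<subseteq> V" "card T \<ge> 3" "card V \<ge> 30 * (card T + 1)" "t \<in> T"
    and big: "real (card (link (V - T) t)) \<ge> 28/100 * (real (card V - card T))\<^sup>2"
  shows "card (meeting T) < card T * ((card V - card T)\<^sup>2 div 4)"
proof -
  define N M q where "N = real (card V - card T)" and "M = real (card T)"
    and "q = real ((card V - card T)\<^sup>2 div 4)"
  define e where "e = real (card (link (V - T) t))"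
  have fin: "finite T" using T finite_V finite_subset by metis
  have cle: "card T \<le> card V" using T finite_V by (simp add: card_mono)
  have V: "real (card V) = N + M" unfolding N_def M_def using cle by (simp add: of_nat_diff)
  have "real (card V) \<ge> real (30 * (card T + 1))" using T by (simp only: of_nat_le_iff)
  then have N: "N \<ge> 29 * M + 30" "M \<ge> 3" using V T unfolding M_def by simp_all
  have "covered T \<subseteq> pairs T" unfolding covered_def by auto
  then have "card (covered T) \<le> card T choose 2"
    using card_mono[of "pairs T" "covered T"] fin by (simp add: finite_pairs card_pairs)
  then have P: "real (card (covered T)) \<le> M * (M - 1) / 2"
    unfolding M_def choose_two_real[symmetric] by simp
  have "real (card (meeting T)) \<le> real ((\<Sum>t\<in>T. card (link (V - T) t)) + card (covered T) * card V)"
    using card_meeting_le[OF T(1)] by (simp only: of_nat_le_iff)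
  also have "\<dots> = (\<Sum>t\<in>T. real (card (link (V - T) t))) + real (card (covered T)) * (N + M)"
    using V by simp
  also have "\<dots> \<le> (e + (M - 1) * (2 * q - e)) + M * (M - 1) / 2 * (N + M)"
    using sum_links_of_large[OF T(1,4)] P N unfolding e_def M_def[symmetric] q_def
    by (intro add_mono mult_right_mono) auto
  also have "\<dots> = M * q - (M - 2) * (e - q) + M * (M - 1) / 2 * (N + M)"
    by (simp add: field_simps)
  also have "\<dots> < M * q"
  proof -
    have "q \<le> N\<^sup>2 / 4" unfolding q_def N_def by (rule quarter_square_le)
    then have "e - q \<ge> 3/100 * N\<^sup>2" using big unfolding e_def[symmetric] N_def[symmetric] by simp
    then have "(M - 2) * (e - q) \<ge> (M - 2) * (3/100 * N\<^sup>2)" using N by (intro mult_left_mono) auto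
    moreover have "(M - 2) * (3/100 * N\<^sup>2) \<ge> (M - 2) * (3/100 * (29 * (M + 1) * N))"
      unfolding power2_eq_square using N by (intro mult_left_mono mult_right_mono) auto
    moreover have "M * (M - 1) / 2 * (N + M) \<le> M * (M - 1) / 2 * (30/29 * N)"
      using N by (intro mult_left_mono) auto
    moreover have "M * (M - 1) / 2 * (30/29 * N) < (M - 2) * (3/100 * (29 * (M + 1) * N))"
    proof -
      have "3 * 2 \<le> M * (M - 1)" using N by (intro mult_mono) auto
      moreover have "(M - 2) * (M + 1) = M * (M - 1) - 2" by (simp add: algebra_simps)
      ultimately have "M * (M - 1) * (15/29) < (M - 2) * (M + 1) * (87/100)" by linarith
      then have "M * (M - 1) * (15/29) * N < (M - 2) * (M + 1) * (87/100) * N"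
        using N by (intro mult_strict_right_mono) auto
      moreover have "M * (M - 1) / 2 * (30/29 * N) = M * (M - 1) * (15/29) * N"
        "(M - 2) * (3/100 * (29 * (M + 1) * N)) = (M - 2) * (M + 1) * (87/100) * N" by simp_all
      ultimately show ?thesis by (simp only:)
    qed
    ultimately show ?thesis by linarith
  qed
  finally have "real (card (meeting T)) < real (card T * ((card V - card T)\<^sup>2 div 4))"
    unfolding M_def q_def by simp
  then show ?thesis by (simp only: of_nat_less_iff)
qed

text \<open>
  Let \<open>N = card V - card T\<close> and \<open>q = N\<^sup>2 div 4\<close>. The sizes of the links are averaged over the pairs of \<open>T\<close>. A covered pair falls short of \<open>2 * q\<close> by
  about \<open>4/100 * N\<^sup>2\<close> by \<open>nearly_disjoint_sum_le\<close>. It contributes at most \<open>card V\<close> edges, which in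
  this averaged count weigh \<open>(card T - 1) * card V\<close>, at most \<open>30/841 * N\<^sup>2\<close>.
\<close>

lemma card_meeting_less_of_covered:
  assumes T: "T \<subseteq> V" "card T \<ge> 3" "card V \<ge> 30 * (card T + 1)"
    and small: "\<And>t. t \<in> T \<Longrightarrow> real (card (link (V - T) t)) < 28/100 * (real (card V - card T))\<^sup>2"
    and cov: "covered T \<noteq> {}"
  shows "card (meeting T) < card T * ((card V - card T)\<^sup>2 div 4)"
proof -
  define N M q where "N = real (card V - card T)" and "M = real (card T)"
    and "q = real ((card V - card T)\<^sup>2 div 4)"
  define e where "e t = real (card (link (V - T) t))" for t
  define P where "P = real (card (covered T))"
  have fin: "finite T" using T finite_V finite_subset by metis
  have cle: "card T \<le> card V" using T finite_V by (simp add: card_mono)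
  have cU: "card (V - T) = card V - card T" using T fin by (simp add: card_Diff_subset)
  have V: "real (card V) = N + M" unfolding N_def M_def using cle by (simp add: of_nat_diff)
  have "real (card V) \<ge> real (30 * (card T + 1))" using T by (simp only: of_nat_le_iff)
  then have N: "N \<ge> 29 * M + 30" "M \<ge> 3" using V T unfolding M_def by simp_all
  have finc: "finite (covered T)" "covered T \<subseteq> pairs T"
    using finite_pairs[OF fin] unfolding covered_def by auto
  have P1: "P \<ge> 1" using cov finc unfolding P_def by (simp add: Suc_le_eq card_gt_0_iff)
  have q: "q \<ge> (N\<^sup>2 - 1) / 4" unfolding q_def N_def by (rule quarter_square_ge)
  have w1: "sum e p \<le> 2 * q" if "p \<in> pairs T" for p
  proof -
    from that obtain s t where st: "p = {s, t}" "s \<noteq> t" "s \<in> T" "t \<in> T" by (rule pairsE)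
    then have "card (link (V - T) s) + card (link (V - T) t) \<le> 2 * ((card V - card T)\<^sup>2 div 4)"
      using sum_two_links_le T by blast
    then have "e s + e t \<le> 2 * q" unfolding e_def q_def by linarith
    then show ?thesis using st by simp
  qed
  have w2: "sum e p \<le> 46/100 * N\<^sup>2" if p: "p \<in> covered T" for p
  proof -
    have "p \<in> pairs T" using p finc by auto
    then obtain s t where st: "p = {s, t}" "s \<noteq> t" "s \<in> T" "t \<in> T" by (rule pairsE)
    then obtain f where f: "f \<in> E" "{s, t} \<subseteq> f" using p unfolding covered_def by auto
    obtain x where x: "\<And>p. p \<in> link (V - T) s \<Longrightarrow> p \<in> link (V - T) t \<Longrightarrow> x \<in> p"
      using covered_pair_common_link[OF st(3,4,2) f] by blast
    have "real (card (link (V - T) s)) + real (card (link (V - T) t))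
        \<le> 46/100 * (real (card (V - T)))\<^sup>2"
    proof (rule nearly_disjoint_sum_le[where x = x])
      show "100 \<le> card (V - T)" using N unfolding cU N_def M_def by linarith
      show "triangle_free_over (link (V - T) s) (link (V - T) t)"
        "triangle_free_over (link (V - T) t) (link (V - T) s)"
        using st by (auto intro: link_triangle_free)
      show "real (card (link (V - T) s)) < 28/100 * (real (card (V - T)))\<^sup>2"
        "real (card (link (V - T) t)) < 28/100 * (real (card (V - T)))\<^sup>2"
        unfolding cU using small st by auto
    qed (use finite_V link_subset x in auto)
    then show ?thesis using st unfolding e_def N_def cU by simp
  qed
  have "(M - 1) * sum e T = (\<Sum>p\<in>pairs T. sum e p)"
    using sum_over_pairs[OF fin, of e] unfolding M_def by simp
  also have "\<dots> \<le> (\<Sum>p\<in>pairs T. 2 * q - (if p \<in> covered T then 2 * q - 46/100 * N\<^sup>2 else 0))"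
    using w1 w2 by (intro sum_mono) auto
  also have "\<dots> = real (card (pairs T)) * (2 * q) - P * (2 * q - 46/100 * N\<^sup>2)"
    using finite_pairs[OF fin] finc(2) unfolding P_def
    by (simp add: sum_subtractf sum.If_cases Int_absorb1)
  also have "real (card (pairs T)) = M * (M - 1) / 2"
    using fin by (simp add: card_pairs choose_two_real M_def)
  also have "M * (M - 1) / 2 * (2 * q) = (M - 1) * (M * q)" by simp
  finally have S: "(M - 1) * sum e T \<le> (M - 1) * (M * q) - P * (2 * q - 46/100 * N\<^sup>2)" .
  have "real (card (meeting T)) \<le> real ((\<Sum>t\<in>T. card (link (V - T) t)) + card (covered T) * card V)"
    using card_meeting_le[OF T(1)] by (simp only: of_nat_le_iff)
  also have "\<dots> = sum e T + P * (N + M)" using V unfolding e_def P_def by simp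
  finally have "(M - 1) * real (card (meeting T)) \<le> (M - 1) * (sum e T + P * (N + M))"
    using N by (intro mult_left_mono) auto
  also have "\<dots> = (M - 1) * sum e T + P * ((M - 1) * (N + M))" by (simp add: algebra_simps)
  also have "\<dots> \<le> (M - 1) * (M * q) - P * (2 * q - 46/100 * N\<^sup>2 - (M - 1) * (N + M))"
    using S by (simp add: algebra_simps)
  also have "\<dots> < (M - 1) * (M * q)"
  proof -
    have "(M - 1) * (N + M) \<le> (N / 29) * (30/29 * N)" using N by (intro mult_mono) auto
    then have 1: "(M - 1) * (N + M) \<le> 30/841 * N\<^sup>2" by (simp add: power2_eq_square)
    have "100 * 100 \<le> N * N" using N by (intro mult_mono) auto
    then have "10000 \<le> N\<^sup>2" by (simp add: power2_eq_square)
    then have "2 * q - 46/100 * N\<^sup>2 - (M - 1) * (N + M) > 0" using 1 q by simp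
    then show ?thesis using P1 by simp
  qed
  finally have "real (card (meeting T)) < M * q" using N by simp
  then have "real (card (meeting T)) < real (card T * ((card V - card T)\<^sup>2 div 4))"
    unfolding M_def q_def by simp
  then show ?thesis by (simp only: of_nat_less_iff)
qed

text \<open>
  Without covered pairs only the links count. Either all of them have at most \<open>q\<close> edges, or one has more
  and the total is strictly smaller because \<open>card T \<ge> 3\<close>.
\<close>

lemma card_meeting_uncovered:
  assumes T: "T \<subseteq> V" "card T \<ge> 3" "card V \<ge> card T + 2" and cov: "covered T = {}"
  defines "q \<equiv> (card V - card T)\<^sup>2 div 4"
  shows "card (meeting T) \<le> card T * q"
    and "card (meeting T) = card T * q \<Longrightarrow> t \<in> T \<Longrightarrow> card (link (V - T) t) = q"
proof -
  let ?e = "\<lambda>t. card (link (V - T) t)"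
  have fin: "finite T" using T finite_V finite_subset by metis
  have m: "card (meeting T) \<le> (\<Sum>t\<in>T. ?e t)" using card_meeting_le[OF T(1)] cov by simp
  have less: "card (meeting T) < card T * q" if t: "t \<in> T" "?e t > q" for t
  proof -
    define M c where "M = real (card T)" and "c = real (?e t)"
    have M: "M \<ge> 3" using T unfolding M_def by simp
    have "real (card (meeting T)) \<le> (\<Sum>t\<in>T. real (?e t))"
      using m by (simp flip: of_nat_sum)
    also have "\<dots> \<le> c + (M - 1) * (2 * real q - c)"
      using sum_links_of_large[OF T(1) t(1)] unfolding q_def M_def c_def by simp
    also have "\<dots> = M * q - (M - 2) * (c - q)" by (simp add: algebra_simps)
    also have "\<dots> < M * q" using M t unfolding c_def by simp
    finally have "real (card (meeting T)) < real (card T * q)" unfolding M_def by simp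
    then show ?thesis by (simp only: of_nat_less_iff)
  qed
  show le: "card (meeting T) \<le> card T * q"
  proof (cases "\<exists>t\<in>T. ?e t > q")
    case True
    then show ?thesis using less by (auto intro: less_imp_le)
  next
    case False
    then have "(\<Sum>t\<in>T. ?e t) \<le> (\<Sum>t\<in>T. q)" by (intro sum_mono) auto
    then show ?thesis using m by simp
  qed
  show "?e t = q" if eq: "card (meeting T) = card T * q" and t: "t \<in> T"
  proof (rule ccontr)
    assume "?e t \<noteq> q"
    moreover have le: "?e s \<le> q" if "s \<in> T" for s using less[OF that] eq by fastforce
    ultimately have "?e t < q" using t by (simp add: le_neq_implies_less)
    then have "(\<Sum>t\<in>T. ?e t) < (\<Sum>t\<in>T. q)" using fin t le by (intro sum_strict_mono_ex1) auto
    then show False using m eq by simp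
  qed
qed

text \<open>
  In the case of equality no pair of \<open>T\<close> is covered and all links have the same number of edges, so any
  two of them attain equality in \<open>sum_two_links_le\<close> and are the same balanced complete bipartite graph.
\<close>

theorem card_meeting_le_quarter:
  assumes T: "T \<subseteq> V" "card T \<ge> 3" "card V \<ge> 30 * (card T + 1)"
  shows "card (meeting T) \<le> card T * ((card V - card T)\<^sup>2 div 4)"
    and "card (meeting T) = card T * ((card V - card T)\<^sup>2 div 4) \<Longrightarrow>
      \<exists>A B. A \<union> B = V - T \<and> A \<inter> B = {} \<and> card A = (card V - card T) div 2 \<and>
        meeting T = {{t, a, b} | t a b. t \<in> T \<and> a \<in> A \<and> b \<in> B}"
proof -
  have dichotomy: "card (meeting T) < card T * ((card V - card T)\<^sup>2 div 4) \<or> covered T = {}"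
    using card_meeting_less_of_dominant[OF T] card_meeting_less_of_covered[OF T]
    by (meson not_le)
  have big: "card V \<ge> card T + 2" using T by simp
  show "card (meeting T) \<le> card T * ((card V - card T)\<^sup>2 div 4)"
    using dichotomy card_meeting_uncovered(1)[OF T(1,2) big] by auto
  assume eq: "card (meeting T) = card T * ((card V - card T)\<^sup>2 div 4)"
  then have cov: "covered T = {}" using dichotomy by simp
  note q = card_meeting_uncovered(2)[OF T(1,2) big cov eq]
  have fin: "finite T" using T finite_V finite_subset by metis
  have cU: "card (V - T) = card V - card T" using T fin by (simp add: card_Diff_subset)
  have U: "finite (V - T)" "card (V - T) \<ge> 2" using finite_V big cU by auto
  have pair: "\<exists>A B. A \<union> B = V - T \<and> A \<inter> B = {} \<and> card A = (card V - card T) div 2 \<and>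
      link (V - T) s = bipairs A B \<and> link (V - T) t = bipairs A B"
    if st: "s \<in> T" "t \<in> T" "s \<noteq> t" for s t
  proof -
    have "triangle_free_over (link (V - T) s) (link (V - T) t)"
      "triangle_free_over (link (V - T) t) (link (V - T) s)"
      using st by (auto intro: link_triangle_free)
    moreover have "card (link (V - T) s) + card (link (V - T) t) = 2 * ((card (V - T))\<^sup>2 div 4)"
      using q st cU by simp
    ultimately obtain A B where "A \<union> B = V - T" "A \<inter> B = {}" "card A = card (V - T) div 2"
      "link (V - T) s = bipairs A B" "link (V - T) t = bipairs A B"
      by (rule sum_two_graphs_eq[OF U link_subset link_subset])
    then show ?thesis unfolding cU by blast
  qed
  have "\<not> card T \<le> Suc 0" using T by simp
  then obtain s t where st: "s \<in> T" "t \<in> T" "s \<noteq> t"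
    using card_le_Suc0_iff_eq[OF fin] by blast
  then obtain A B where AB: "A \<union> B = V - T" "A \<inter> B = {}" "card A = (card V - card T) div 2"
    "link (V - T) s = bipairs A B" using pair[OF st] by blast
  have all: "link (V - T) u = bipairs A B" if "u \<in> T" for u
  proof (cases "u = s")
    case False
    then have "link (V - T) s = link (V - T) u"
      using pair[OF st(1) that] by auto
    then show ?thesis using AB(4) by simp
  qed (use AB in simp)
  have "meeting T = (\<Union>t\<in>T. insert t ` bipairs A B)"
    using meeting_eq_of_uncovered[OF cov] all by simp
  also have "\<dots> = {{t, a, b} | t a b. t \<in> T \<and> a \<in> A \<and> b \<in> B}"
    unfolding bipairs_def by auto
  finally show "\<exists>A B. A \<union> B = V - T \<and> A \<inter> B = {} \<and> card A = (card V - card T) div 2 \<and>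
        meeting T = {{t, a, b} | t a b. t \<in> T \<and> a \<in> A \<and> b \<in> B}"
    using AB by blast
qed

section \<open>Matching number one and two\<close>

lemma card_le_of_cover_vertex:
  assumes "x \<in> V" "\<And>e. e \<in> E \<Longrightarrow> x \<in> e"
  shows "card E \<le> (card V - 1) choose 2"
    and "card E = (card V - 1) choose 2 \<Longrightarrow> E = {e. e \<subseteq> V \<and> card e = 3 \<and> x \<in> e}"
proof -
  let ?S = "{e. e \<subseteq> V \<and> card e = 3 \<and> x \<in> e}"
  have sub: "E \<subseteq> ?S" using assms edge_subset card_edge by auto
  have fin: "finite ?S" using finite_V by auto
  show "card E \<le> (card V - 1) choose 2"
    using card_mono[OF fin sub] card_star[OF finite_V assms(1)] by simp
  show "E = ?S" if "card E = (card V - 1) choose 2"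
    using card_subset_eq[OF fin sub] card_star[OF finite_V assms(1)] that by simp
qed

text \<open>
  Let \<open>N = card V - 2\<close> and let \<open>C\<close> be the set of the \<open>x\<close> such that \<open>{s, t, x}\<close> is an edge. If the links of \<open>s\<close> and \<open>t\<close> share a pair
  then \<open>C\<close> is contained in that pair. If they are disjoint they have at most \<open>N choose 2\<close> edges together,
  and \<open>C\<close> adds at most \<open>N\<close>. Equality means that the links partition all pairs and
  \<open>C\<close> is everything; then an edge of one link is never adjacent to an edge of the other, so that one of
  the links is empty.
\<close>

lemma card_le_of_cover_pair:
  assumes st: "s \<in> V" "t \<in> V" "s \<noteq> t" and cov: "avoiding {s, t} = {}" and n: "card V \<ge> 7"
  shows "card E \<le> (card V - 1) choose 2"
    and "card E = (card V - 1) choose 2 \<Longrightarrow> \<exists>x\<in>V. E = {e. e \<subseteq> V \<and> card e = 3 \<and> x \<in> e}"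
proof -
  define U where "U = V - {s, t}"
  define G1 where "G1 = link U s"
  define G2 where "G2 = link U t"
  define C where "C = {x \<in> U. {s, t, x} \<in> E}"
  define N where "N = card U"
  have U: "finite U" using finite_V unfolding U_def by auto
  have N: "card V = N + 2"
    using st finite_V card_mono[of V "{s, t}"] unfolding N_def U_def by (simp add: card_Diff_subset)
  have fin: "finite G1" "finite G2" "finite C" "G1 \<subseteq> pairs U" "G2 \<subseteq> pairs U"
    using U finite_link[of U] link_subset unfolding G1_def G2_def C_def U_def by auto
  have choose: "(card V - 1) choose 2 = (N choose 2) + N"
    using N by (simp add: numeral_2_eq_2)
  have tf: "triangle_free_over G1 G2" "triangle_free_over G2 G1"
    unfolding G1_def G2_def U_def using st by (auto intro: link_triangle_free)
  have Esub: "E \<subseteq> insert s ` G1 \<union> insert t ` G2 \<union> (\<lambda>x. {s, t, x}) ` C"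
  proof
    fix e assume e: "e \<in> E"
    have c3: "card e = 3" "finite e" "e \<subseteq> V" using e card_edge finite_edge edge_subset by auto
    have link: "e \<in> insert u ` link U u" if "u \<in> e" "e - {u} \<subseteq> U" for u
    proof -
      have "insert u (e - {u}) = e" using that by auto
      moreover have "e - {u} \<in> link U u"
        using that e c3 \<open>insert u (e - {u}) = e\<close> unfolding link_def pairs_def
        by (simp add: card_Diff_singleton)
      ultimately show ?thesis by (metis imageI)
    qed
    have "s \<in> e \<or> t \<in> e" using cov e unfolding avoiding_def by auto
    then consider "s \<in> e" "t \<in> e" | "s \<in> e" "t \<notin> e" | "s \<notin> e" "t \<in> e" by blast
    then show "e \<in> insert s ` G1 \<union> insert t ` G2 \<union> (\<lambda>x. {s, t, x}) ` C"
    proof cases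
      case 1
      then have "card (e - {s, t}) = 1" using c3 st by (simp add: card_Diff_subset)
      then obtain x where "e - {s, t} = {x}" by (auto simp: card_1_singleton_iff)
      then have x: "e = {s, t, x}" "x \<notin> {s, t}" "x \<in> e" using 1 by auto
      then have "x \<in> C" using e c3 unfolding C_def U_def by auto
      then show ?thesis using x by auto
    next
      case 2
      then show ?thesis using link[of s] c3 unfolding U_def G1_def by auto
    next
      case 3
      then show ?thesis using link[of t] c3 unfolding U_def G2_def by auto
    qed
  qed
  then have "card E \<le> card (insert s ` G1 \<union> insert t ` G2 \<union> (\<lambda>x. {s, t, x}) ` C)"
    using fin by (intro card_mono) auto
  also have "\<dots> \<le> card (insert s ` G1) + card (insert t ` G2) + card ((\<lambda>x. {s, t, x}) ` C)"
    by (meson card_Un_le add_le_mono1 le_trans)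
  also have "\<dots> \<le> card G1 + card G2 + card C"
    using fin by (intro add_mono card_image_le) auto
  finally have cE: "card E \<le> card G1 + card G2 + card C" .
  have CN: "card C \<le> N" using U unfolding C_def N_def by (intro card_mono) auto
  show le: "card E \<le> (card V - 1) choose 2"
    and eq: "card E = (card V - 1) choose 2 \<Longrightarrow> \<exists>x\<in>V. E = {e. e \<subseteq> V \<and> card e = 3 \<and> x \<in> e}"
  proof -
    consider "G1 \<inter> G2 \<noteq> {}" | "G1 \<inter> G2 = {}" by blast
    then have "card E \<le> (card V - 1) choose 2 \<and> (card E = (card V - 1) choose 2 \<longrightarrow>
      (\<exists>x\<in>V. E = {e. e \<subseteq> V \<and> card e = 3 \<and> x \<in> e}))"
    proof cases
      case 1
      then obtain p where p: "p \<in> G1" "p \<in> G2" by auto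
      then have "p \<in> pairs U" using fin by auto
      then obtain y z where yz: "p = {y, z}" "y \<noteq> z" "y \<in> U" "z \<in> U" by (rule pairsE)
      have "C \<subseteq> {y, z}"
      proof (rule subsetI, rule ccontr)
        fix x assume x: "x \<in> C" "x \<notin> {y, z}"
        then have "distinct [y, z, s, t, x]" using yz st unfolding C_def U_def by auto
        moreover have "insert s p = {y, z, s}" "insert t p = {y, z, t}" using yz by auto
        then have "{y, z, s} \<in> E" "{y, z, t} \<in> E" "{s, t, x} \<in> E"
          using p x unfolding G1_def G2_def link_def C_def by auto
        ultimately show False using F5_free by blast
      qed
      then have "card C \<le> 2" using card_mono[of "{y, z}" C] yz by auto
      moreover have "card G1 + card G2 \<le> 2 * (N\<^sup>2 div 4)"
        using sum_two_graphs_le[OF U fin(4,5) tf] unfolding N_def .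
      moreover have "2 * (N\<^sup>2 div 4) + 2 < (N choose 2) + N"
      proof -
        have "real (N choose 2) = ((real N)\<^sup>2 - real N) / 2"
          unfolding choose_two_real by (simp add: power2_eq_square right_diff_distrib)
        then have "real (2 * (N\<^sup>2 div 4) + 2) < real ((N choose 2) + N)"
          using quarter_square_le[of N] n N by simp
        then show ?thesis by (simp only: of_nat_less_iff)
      qed
      ultimately show ?thesis using cE choose by linarith
    next
      case 2
      have c12: "card G1 + card G2 = card (G1 \<union> G2)" using fin 2 by (simp add: card_Un_disjoint)
      have fp: "finite (pairs U)" using U by (rule finite_pairs)
      have sub: "G1 \<union> G2 \<subseteq> pairs U" using fin by auto
      have le2: "card (G1 \<union> G2) \<le> N choose 2"
        using card_mono[OF fp sub] U unfolding N_def by (simp add: card_pairs)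
      have le3: "card E \<le> (card V - 1) choose 2" using cE c12 le2 CN choose by linarith
      have "\<exists>x\<in>V. E = {e. e \<subseteq> V \<and> card e = 3 \<and> x \<in> e}" if eq: "card E = (card V - 1) choose 2"
      proof -
        have "card (G1 \<union> G2) = N choose 2" "card C = N" using cE c12 le2 CN choose eq by linarith+
        then have all: "G1 \<union> G2 = pairs U" "C = U"
          using card_subset_eq[OF fp sub] card_subset_eq[OF U, of C] U
          unfolding N_def C_def by (auto simp: card_pairs)
        (* Since {s, x, t} and {s, x, y} are edges, {t, y, z} cannot be one. *)
        have adj: False if "{x, y} \<in> G1" "{y, z} \<in> G2" for x y z
        proof -
          have "{x, y} \<in> pairs U" "{y, z} \<in> pairs U" using that fin by blast+
          then have xyz: "x \<in> U" "y \<in> U" "z \<in> U" "x \<noteq> y" "y \<noteq> z"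
            by (simp_all add: in_pairs_iff)
          have "x \<noteq> z" using that 2 by (auto simp: insert_commute)
          then have "distinct [s, x, t, y, z]" using xyz st unfolding U_def by auto
          moreover have "{s, x, t} \<in> E"
            using all(2) xyz unfolding C_def by (auto simp: insert_commute)
          moreover have "{s, x, y} \<in> E" "{t, y, z} \<in> E"
            using that unfolding G1_def G2_def link_def by auto
          ultimately show False using F5_free by blast
        qed
        have "G1 = {} \<or> G2 = {}"
        proof (rule ccontr)
          assume "\<not> (G1 = {} \<or> G2 = {})"
          then obtain p p' where p: "p \<in> G1" "p' \<in> G2" by auto
          then have "p \<in> pairs U" "p' \<in> pairs U" using fin by auto
          from this(1) obtain x y where xy: "p = {x, y}" "x \<in> U" "y \<in> U" by (rule pairsE)
          from \<open>p' \<in> pairs U\<close> obtain a b where ab: "p' = {a, b}" "a \<in> U" "b \<in> U" by (rule pairsE)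
          show False
          proof (cases "y = a")
            case True
            then show False using adj[of x y b] p xy ab by simp
          next
            case False
            then have "{y, a} \<in> G1 \<union> G2" using xy ab all(1) by (simp add: in_pairs_iff)
            then show False using adj[of x y a] adj[of y a b] p xy ab by auto
          qed
        qed
        then obtain x where x: "x \<in> V" "\<And>e. e \<in> E \<Longrightarrow> x \<in> e"
        proof
          assume "G1 = {}"
          then show thesis using that[of t] Esub st by blast
        next
          assume "G2 = {}"
          then show thesis using that[of s] Esub st by blast
        qed
        then show ?thesis using card_le_of_cover_vertex(2)[OF x eq] by blast
      qed
      then show ?thesis using le3 by blast
    qed
    then show "card E \<le> (card V - 1) choose 2"
      "card E = (card V - 1) choose 2 \<Longrightarrow> \<exists>x\<in>V. E = {e. e \<subseteq> V \<and> card e = 3 \<and> x \<in> e}" by blast+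
  qed
qed

text \<open>
  The edges avoiding \<open>t\<close> form an intersecting family \<open>H\<close> that no single vertex covers, hence nine pairs
  cover it: three at each vertex of one of its edges. So if \<open>D\<close> is the largest codegree in \<open>H\<close>,
  then \<open>H\<close> has at most \<open>9 * D\<close> edges. On the other hand the link of \<open>t\<close> misses \<open>D choose 2\<close>
  pairs by \<open>link_of_codegree_set\<close>, and \<open>2 * (card V - 4)\<close> pairs because of a
  single edge of \<open>H\<close> by \<open>card_meeting_edge_at_vertex\<close>. The first loss exceeds \<open>9 * D\<close> for \<open>D \<ge> 20\<close>,
  the second one does for \<open>D \<le> 19\<close> as soon as \<open>card V \<ge> 90\<close>.
\<close>

lemma card_less_star_of_intersecting_remainder:
  assumes t: "t \<in> V" and k: "matching_le (avoiding {t}) 1"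
    and nc: "\<And>v. v \<in> V \<Longrightarrow> \<exists>e\<in>avoiding {t}. v \<notin> e" and n: "card V \<ge> 90"
  shows "card E < (card V - 1) choose 2"
proof -
  define H where "H = avoiding {t}"
  have HE: "H \<subseteq> E" "\<And>e. e \<in> H \<Longrightarrow> t \<notin> e" unfolding H_def avoiding_def by auto
  have fH: "finite H" using HE finite_E finite_subset by metis
  have int: "e \<inter> f \<noteq> {}" if "e \<in> H" "f \<in> H" for e f
  proof
    assume d: "e \<inter> f = {}"
    have "e \<noteq> {}" using that HE card_edge by fastforce
    then have "e \<noteq> f" using d by auto
    moreover have "card {e, f} \<le> 1"
      using that d by (intro matching_leD[OF k]) (auto simp: H_def pairwise_insert disjnt_def)
    ultimately show False by simp
  qed
  have split: "card E = card H + card (meeting {t})" unfolding H_def by (rule card_E_split)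
  obtain f where f: "f \<in> H" using nc[OF t] unfolding H_def by auto
  then have fE: "f \<in> E" "t \<notin> f" using HE by auto
  define D where "D = Max ((\<lambda>(u, v). card {e \<in> H. {u, v} \<subseteq> e}) ` {(u, v). u \<in> V \<and> v \<in> V \<and> u \<noteq> v})"
  have fin2: "finite {(u, v). u \<in> V \<and> v \<in> V \<and> u \<noteq> v}"
    using finite_V by (auto intro: finite_subset[of _ "V \<times> V"])
  have DI: "card {e \<in> H. {u, v} \<subseteq> e} \<le> D" if "u \<in> V" "v \<in> V" "u \<noteq> v" for u v
    unfolding D_def using that fin2 by (intro Max_ge) (auto intro!: image_eqI[of _ _ "(u, v)"])
  have "{(u, v). u \<in> V \<and> v \<in> V \<and> u \<noteq> v} \<noteq> {}"
  proof -
    obtain u where "u \<in> f" using fE card_edge[of f] by (metis card.empty equals0I zero_neq_numeral)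
    then have "(u, t) \<in> {(u, v). u \<in> V \<and> v \<in> V \<and> u \<noteq> v}" using fE t edge_subset by auto
    then show ?thesis by blast
  qed
  then have "D \<in> (\<lambda>(u, v). card {e \<in> H. {u, v} \<subseteq> e}) ` {(u, v). u \<in> V \<and> v \<in> V \<and> u \<noteq> v}"
    unfolding D_def using fin2 by (intro Max_in) auto
  then obtain u v where uv: "u \<in> V" "v \<in> V" "u \<noteq> v" "card {e \<in> H. {u, v} \<subseteq> e} = D" by auto
  have "\<forall>v\<in>V. \<exists>g. g \<in> H \<and> v \<notin> g" using nc unfolding H_def by blast
  then obtain g where g: "\<And>v. v \<in> V \<Longrightarrow> g v \<in> H \<and> v \<notin> g v" by metis
  have "H \<subseteq> (\<Union>a\<in>f. \<Union>b\<in>g a. {e \<in> H. {a, b} \<subseteq> e})"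
  proof
    fix e assume e: "e \<in> H"
    obtain a where a: "a \<in> e" "a \<in> f" using int[OF e f] by auto
    then have "a \<in> V" using fE edge_subset by auto
    then obtain b where "b \<in> e" "b \<in> g a" using int[OF e, of "g a"] g by auto
    then show "e \<in> (\<Union>a\<in>f. \<Union>b\<in>g a. {e \<in> H. {a, b} \<subseteq> e})" using a e by auto
  qed
  moreover have ff: "finite f" "card f = 3" "f \<subseteq> V" using fE finite_edge card_edge edge_subset by auto
  have fg: "finite (g a)" "card (g a) = 3" "g a \<subseteq> V" if "a \<in> f" for a
    using g[of a] that ff HE finite_edge card_edge edge_subset by blast+
  ultimately have "card H \<le> card (\<Union>a\<in>f. \<Union>b\<in>g a. {e \<in> H. {a, b} \<subseteq> e})"
    using fH ff by (intro card_mono finite_UN_I) auto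
  also have "\<dots> \<le> (\<Sum>a\<in>f. card (\<Union>b\<in>g a. {e \<in> H. {a, b} \<subseteq> e}))" by (rule card_UN_le[OF ff(1)])
  also have "\<dots> \<le> (\<Sum>a\<in>f. 3 * D)"
  proof (rule sum_mono)
    fix a assume a: "a \<in> f"
    have "card (\<Union>b\<in>g a. {e \<in> H. {a, b} \<subseteq> e}) \<le> (\<Sum>b\<in>g a. card {e \<in> H. {a, b} \<subseteq> e})"
      by (rule card_UN_le[OF fg(1)[OF a]])
    also have "\<dots> \<le> (\<Sum>b\<in>g a. D)"
    proof (rule sum_mono)
      fix b assume "b \<in> g a"
      then show "card {e \<in> H. {a, b} \<subseteq> e} \<le> D"
        using DI[of a b] a ff fg(3)[OF a] g[of a] by auto
    qed
    finally show "card (\<Union>b\<in>g a. {e \<in> H. {a, b} \<subseteq> e}) \<le> 3 * D" using fg(2)[OF a] by simp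
  qed
  finally have H9: "card H \<le> 9 * D" using ff by simp
  show ?thesis
  proof (cases "D \<ge> 20")
    case True
    define X where "X = {x. {u, v, x} \<in> H}"
    have XV: "X \<subseteq> V - {t}" using HE edge_subset unfolding X_def by blast
    then have fX: "finite X" using finite_V by (meson finite_Diff finite_subset)
    have "{e \<in> H. {u, v} \<subseteq> e} \<subseteq> (\<lambda>x. {u, v, x}) ` X"
    proof
      fix e assume e: "e \<in> {e \<in> H. {u, v} \<subseteq> e}"
      then have "card (e - {u, v}) = 1"
        using HE card_edge[of e] uv by (auto simp: card_Diff_subset)
      then obtain x where "e - {u, v} = {x}" by (auto simp: card_1_singleton_iff)
      then have "e = {u, v, x}" using e by auto
      then show "e \<in> (\<lambda>x. {u, v, x}) ` X" using e unfolding X_def by auto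
    qed
    from card_mono[OF _ this] have "D \<le> card ((\<lambda>x. {u, v, x}) ` X)" using uv(4) fX by simp
    also have "\<dots> \<le> card X" by (rule card_image_le[OF fX])
    finally have DX: "D \<le> card X" .
    then have "X \<noteq> {}" using True by auto
    then obtain x where "{u, v, x} \<in> H" unfolding X_def by blast
    then have tuv: "t \<notin> {u, v}" using HE(2) by blast
    have "link (V - {t}) t \<inter> pairs X = {}"
      using HE(1) tuv uv by (intro link_of_codegree_set) (auto simp: X_def)
    then have "card (link (V - {t}) t) + (card X choose 2) \<le> card (V - {t}) choose 2"
      using finite_V XV by (intro independent_set_card_le link_subset) auto
    moreover have "card (meeting {t}) \<le> card (link (V - {t}) t)"
    proof -
      have "pairs {t} = {}" by (auto elim: pairsE)
      then have "covered {t} = {}" unfolding covered_def by simp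
      then show ?thesis using card_meeting_le[of "{t}"] t by simp
    qed
    moreover have "card (V - {t}) = card V - 1" using t finite_V by simp
    moreover have "9 * card X < card X choose 2"
    proof -
      have "real (card X) * 18 < real (card X) * (real (card X) - 1)"
        using DX True by (intro mult_strict_left_mono) auto
      then have "real (9 * card X) < real (card X choose 2)" unfolding choose_two_real by simp
      then show ?thesis by (simp only: of_nat_less_iff)
    qed
    ultimately show ?thesis using split H9 DX by simp
  next
    case False
    then have H: "card H \<le> 171" using H9 by simp
    let ?A = "{e \<in> E. t \<in> e \<and> e \<inter> f \<noteq> {}}"
    let ?W = "V - insert t f"
    have cW: "card ?W = card V - 4"
      using ff fE t finite_V by (simp add: card_Diff_subset)
    have "meeting {t} \<subseteq> ?A \<union> insert t ` pairs ?W"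
    proof
      fix e assume e: "e \<in> meeting {t}"
      then have e': "e \<in> E" "t \<in> e" unfolding meeting_def by auto
      show "e \<in> ?A \<union> insert t ` pairs ?W"
      proof (cases "e \<inter> f = {}")
        case True
        then have "e - {t} \<in> pairs ?W"
          using e' card_edge finite_edge edge_subset[OF e'(1)]
          unfolding pairs_def by (auto simp: card_Diff_singleton)
        moreover have "e = insert t (e - {t})" using e' by auto
        ultimately show ?thesis by blast
      qed (use e' in auto)
    qed
    then have "card (meeting {t}) \<le> card (?A \<union> insert t ` pairs ?W)"
      using finite_E finite_V by (intro card_mono) (auto simp: finite_pairs)
    also have "\<dots> \<le> card ?A + card (insert t ` pairs ?W)" by (rule card_Un_le)
    also have "card (insert t ` pairs ?W) \<le> (card V - 4) choose 2"
      using card_image_le[of "pairs ?W" "insert t"] finite_V cW by (simp add: finite_pairs card_pairs)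
    finally have "card (meeting {t}) \<le> card ?A + ((card V - 4) choose 2)" by simp
    moreover have "card ?A + 1 \<le> card V" using card_meeting_edge_at_vertex[OF fE(1) t fE(2)] .
    ultimately have "card E + 1 \<le> 171 + card V + ((card V - 4) choose 2)" using split H by linarith
    moreover have "171 + card V + ((card V - 4) choose 2) < ((card V - 1) choose 2) + 1"
    proof -
      have "real (171 + card V + ((card V - 4) choose 2)) < real (((card V - 1) choose 2) + 1)"
        using n by (simp add: choose_two_real of_nat_diff field_simps)
      then show ?thesis by (simp only: of_nat_less_iff)
    qed
    ultimately show ?thesis by linarith
  qed
qed

text \<open>
  If no two vertices cover all edges, the set \<open>T\<close> of \<open>ex_partial_cover\<close> has at most one element. If it
  is empty, the number of edges is linear in \<open>card V\<close>; if it is a single vertex \<open>t\<close>, then \<open>s = 2\<close>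
  and the edges avoiding \<open>t\<close> are intersecting.
\<close>

theorem card_le_star:
  assumes s: "s = 1 \<or> s = 2" and k: "matching_le E s" and n: "card V \<ge> 30 * (s + 1)"
  shows "card E \<le> (card V - 1) choose 2 \<and> (card E = (card V - 1) choose 2 \<longrightarrow>
    (\<exists>x\<in>V. E = {e. e \<subseteq> V \<and> card e = 3 \<and> x \<in> e}))"
proof (cases "\<exists>a\<in>V. \<exists>b\<in>V. a \<noteq> b \<and> avoiding {a, b} = {}")
  case True
  then show ?thesis using card_le_of_cover_pair s n by fastforce
next
  case False
  obtain T where T: "T \<subseteq> V" "card T \<le> s" "matching_le (avoiding T) (s - card T)"
    "card (avoiding T) \<le> 3 * (s - card T)\<^sup>2 * card V" using ex_partial_cover[OF k] .
  have fin: "finite T" using T finite_V finite_subset by metis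
  have nle: "\<exists>e\<in>avoiding {t}. v \<notin> e" if tv: "t \<in> V" "v \<in> V" for t v
  proof -
    have "\<exists>u\<in>V. u \<noteq> t \<and> (v = t \<or> v = u)"
    proof (cases "v = t")
      case True
      have "V \<noteq> {t}" using n by auto
      then show ?thesis using tv True by auto
    qed (use tv in auto)
    then obtain u where u: "u \<in> V" "u \<noteq> t" "v = t \<or> v = u" by blast
    then obtain e where "e \<in> avoiding {t, u}" using False tv by (metis ex_in_conv)
    then show ?thesis using u unfolding avoiding_def by auto
  qed
  consider "card T = 0" | "card T = 1" | "card T = 2" using T s by linarith
  then have "card E < (card V - 1) choose 2"
  proof cases
    case 1
    then have "avoiding T = E" using fin unfolding avoiding_def by auto
    then have "card E \<le> 3 * s\<^sup>2 * card V" using T(4) 1 by simp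
    also have "3 * s\<^sup>2 \<le> 12" using s by auto
    finally have "card E \<le> 12 * card V" by simp
    moreover have "12 * card V < (card V - 1) choose 2"
    proof -
      have V: "real (card V) \<ge> 60" using n s by auto
      then have "60 * real (card V) \<le> real (card V) * real (card V)" by (intro mult_right_mono) auto
      moreover have "real ((card V - 1) choose 2)
          = (real (card V) * real (card V) - 3 * real (card V) + 2) / 2"
        using V by (subst choose_two_minus_one_real) (auto simp: algebra_simps)
      ultimately have "12 * real (card V) < real ((card V - 1) choose 2)" using V by argo
      then have "real (12 * card V) < real ((card V - 1) choose 2)" by simp
      then show ?thesis by (simp only: of_nat_less_iff)
    qed
    ultimately show ?thesis by linarith
  next
    case 2
    then obtain t where t: "T = {t}" by (auto simp: card_1_singleton_iff)
    have tV: "t \<in> V" using T t by simp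
    show ?thesis
    proof (cases "s = 1")
      case True
      then have "matching_le (avoiding T) 0" using T(3) 2 by simp
      then have "e \<notin> avoiding {t}" for e
        using matching_leD[of "avoiding T" 0 "{e}"] t by auto
      then show ?thesis using nle[OF tV tV] by blast
    next
      case False
      then have "s = 2" using s by simp
      then show ?thesis
        using card_less_star_of_intersecting_remainder[OF tV _ nle[OF tV]] T(3) n t by simp
    qed
  next
    case 3
    then have "card (avoiding T) = 0" using T(2,4) s by auto
    moreover have "finite (avoiding T)" using finite_E unfolding avoiding_def by simp
    ultimately have e: "avoiding T = {}" by simp
    obtain a b where "T = {a, b}" "a \<noteq> b" using 3 by (auto simp: card_2_iff)
    then show ?thesis using False e T(1) by auto
  qed
  then show ?thesis by simp
qed

end

section \<open>Matching number at least three\<close>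

text \<open>
  Here \<open>m\<close> is the size of a partial cover and \<open>k\<close> the matching number of what it leaves. The first summand
  bounds the edges with one vertex in the cover if \<open>m \<noteq> 1\<close>, the second one the edges through both cover
  vertices if \<open>m = 2\<close>, and \<open>3 * k\<^sup>2 * n\<close> the remaining edges. On the right,
  \<open>(x\<^sup>2 - 1) / 4\<close> with \<open>x = n - (m + k)\<close> is a lower bound for the floor of \<open>x\<^sup>2 / 4\<close>. Replacing the remainder by \<open>k\<close> more
  cover vertices gains about \<open>k * n\<^sup>2 / 4\<close> and costs about \<open>m * k * n / 2\<close>, as the other parts shrink, so
  a large ratio of \<open>n\<close> to \<open>m + k\<close> suffices.
\<close>

lemma remainder_estimate:
  fixes n k m :: real
  assumes "k \<ge> 1" "m \<ge> 0" "m + k \<ge> 3" "n \<ge> 30 * (m + k + 1)"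
  shows "m * (n - m)\<^sup>2 / 4 + n + 3 * k\<^sup>2 * n < (m + k) * ((n - (m + k))\<^sup>2 - 1) / 4"
proof -
  define s x where "s = m + k" and "x = n - s"
  have x: "x \<ge> 29 * s + 30" and s: "s \<ge> 3" "k \<le> s" "m \<le> s" "m = s - k" "n = x + s"
    using assms unfolding s_def x_def by simp_all
  have id: "s * x\<^sup>2 - m * (x + k)\<^sup>2 = k * (x\<^sup>2 - 2 * m * x - m * k)"
    unfolding s(4) by (simp add: power2_eq_square algebra_simps)
  have "m * x \<le> s * x" "m * k \<le> s * s" "k * (x + s) \<le> s * (x + s)"
    using s x assms by (auto intro: mult_mono mult_right_mono)
  then have "x\<^sup>2 - 2 * m * x - m * k - 12 * (k * (x + s)) \<ge> x\<^sup>2 - 14 * (s * x) - 13 * (s * s)"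
    by (simp add: algebra_simps)
  moreover define L P Q where "L = x\<^sup>2 - 2 * m * x - m * k - 12 * (k * (x + s))"
    and "P = s * x" and "Q = s * s"
  ultimately have "L \<ge> x\<^sup>2 - 14 * P - 13 * Q" by simp
  moreover have "(29 * s + 30) * x \<le> x * x" "s * (29 * s) \<le> s * x"
    using x s by (intro mult_right_mono mult_left_mono; simp)+
  then have "x\<^sup>2 \<ge> 29 * P + 30 * x" "P \<ge> 29 * Q"
    unfolding P_def Q_def by (simp_all add: power2_eq_square algebra_simps)
  moreover have "Q \<ge> 0" unfolding Q_def by simp
  ultimately have L: "L > 4 * (x + s) + s" using x s(1) by argo
  have "0 \<le> 4 * (x + s) + s" using x s(1) by simp
  then have "0 \<le> L" using L by simp
  then have "1 * L \<le> k * L" using assms(1) by (intro mult_right_mono)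
  then have "k * L > 4 * (x + s) + s" using L by linarith
  moreover have "k * L = k * (x\<^sup>2 - 2 * m * x - m * k) - 12 * k\<^sup>2 * (x + s)"
    unfolding L_def by (simp add: power2_eq_square algebra_simps)
  ultimately have "s * x\<^sup>2 - m * (x + k)\<^sup>2 - 12 * k\<^sup>2 * (x + s) > 4 * (x + s) + s" using id by linarith
  then have "m * (x + k)\<^sup>2 + 4 * (x + s) + 12 * k\<^sup>2 * (x + s) < s * (x\<^sup>2 - 1)"
    by (simp add: algebra_simps)
  moreover have eqs: "x + k = n - m" "x = n - (m + k)" "x + s = n" "s = m + k"
    using s unfolding x_def s_def by auto
  ultimately have "m * (n - m)\<^sup>2 + 4 * n + 12 * k\<^sup>2 * n < (m + k) * ((n - (m + k))\<^sup>2 - 1)"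
    by metis
  then show ?thesis by simp
qed

text \<open>
  The case \<open>m = 1\<close>, in which the link of the only cover vertex can be complete.
\<close>

lemma remainder_estimate_one:
  fixes n k :: real
  assumes "k \<ge> 2" "n \<ge> 30 * (k + 2)"
  shows "(n - 1) * (n - 2) / 2 + 3 * k\<^sup>2 * n < (k + 1) * ((n - (k + 1))\<^sup>2 - 1) / 4"
proof -
  define x where "x = n - (k + 1)"
  have x: "x \<ge> 29 * k + 59" and n: "n = x + k + 1" using assms unfolding x_def by simp_all
  define A B C K W where "A = x * ((k - 1) * x)" and "B = x * k\<^sup>2" and "C = k * k\<^sup>2"
    and "K = k\<^sup>2" and "W = k * x"
  have "(k + 1) * (x\<^sup>2 - 1) - 2 * ((n - 1) * (n - 2)) - 12 * k\<^sup>2 * n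
      = A - 4 * W - 2 * K + 2 * (x + k) - (k + 1) - 12 * B - 12 * (C + K)"
    unfolding n A_def B_def C_def K_def W_def by (simp add: power2_eq_square algebra_simps)
  moreover have "A \<ge> 13 * B + 4 * W"
  proof -
    have "2 * k \<le> k\<^sup>2" unfolding power2_eq_square using assms by (intro mult_right_mono) auto
    moreover have "(k - 1) * (29 * k + 59) = 29 * k\<^sup>2 + 30 * k - 59"
      by (simp add: power2_eq_square algebra_simps)
    ultimately have "13 * k\<^sup>2 + 4 * k \<le> (k - 1) * (29 * k + 59)" using assms by linarith
    also have "\<dots> \<le> (k - 1) * x" using x assms by (intro mult_left_mono) auto
    finally have "x * (13 * k\<^sup>2 + 4 * k) \<le> A"
      unfolding A_def using x assms by (intro mult_left_mono) auto
    then show ?thesis unfolding B_def W_def by (simp add: algebra_simps)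
  qed
  moreover have "(29 * k + 59) * k\<^sup>2 \<le> x * k\<^sup>2" using x by (intro mult_right_mono) auto
  then have "B \<ge> 29 * C + 59 * K" unfolding B_def C_def K_def by (simp add: algebra_simps)
  moreover have "C \<ge> 0" "K \<ge> 0" using assms unfolding C_def K_def by simp_all
  ultimately have "(k + 1) * (x\<^sup>2 - 1) - 2 * ((n - 1) * (n - 2)) - 12 * k\<^sup>2 * n > 0"
    using x assms by argo
  then show ?thesis unfolding x_def by simp
qed

context F5_free_graph
begin

text \<open>
  The estimates show that an extremal 3-graph has a partial cover of full size \<open>s\<close>, that is, a vertex
  cover.
\<close>

theorem card_le_tripartite:
  assumes s: "s \<ge> 3" and k: "matching_le E s" and n: "card V \<ge> 30 * (s + 1)"
  shows "card E \<le> s * ((card V - s)\<^sup>2 div 4)"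
    and "card E = s * ((card V - s)\<^sup>2 div 4) \<Longrightarrow>
      \<exists>T A B. T \<union> A \<union> B = V \<and> T \<inter> A = {} \<and> T \<inter> B = {} \<and> A \<inter> B = {} \<and>
        card T = s \<and> card A = (card V - s) div 2 \<and>
        E = {{t, a, b} | t a b. t \<in> T \<and> a \<in> A \<and> b \<in> B}"
proof -
  obtain T where T: "T \<subseteq> V" "card T \<le> s" "matching_le (avoiding T) (s - card T)"
    "card (avoiding T) \<le> 3 * (s - card T)\<^sup>2 * card V" using ex_partial_cover[OF k] .
  have fin: "finite T" using T finite_V finite_subset by metis
  have split: "card E = card (avoiding T) + card (meeting T)" by (rule card_E_split)
  have less: "card E < s * ((card V - s)\<^sup>2 div 4)" if lt: "card T < s"
  proof -
    define n k m where "n = real (card V)" and "k = real (s - card T)" and "m = real (card T)"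
    have "real (card V) \<ge> real (30 * (s + 1))" using n by (simp only: of_nat_le_iff)
    then have num: "k \<ge> 1" "m \<ge> 0" "m + k = real s" "real s \<ge> 3" "n \<ge> 30 * (real s + 1)"
      using s lt unfolding n_def k_def m_def by (auto simp: of_nat_diff)
    have nm: "real (card V - card T) = n - m" "real (card V - s) = n - real s"
      using T lt s assms(3) unfolding n_def m_def by (simp_all add: of_nat_diff)
    have "real (card (avoiding T)) \<le> real (3 * (s - card T)\<^sup>2 * card V)"
      using T(4) by (simp only: of_nat_le_iff)
    then have av: "real (card (avoiding T)) \<le> 3 * k\<^sup>2 * n" unfolding k_def n_def by simp
    have rhs: "real s * ((n - real s)\<^sup>2 - 1) / 4 \<le> real (s * ((card V - s)\<^sup>2 div 4))"
      using quarter_square_ge[of "card V - s"] nm num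
      by (simp add: mult_left_mono flip: times_divide_eq_right)
    have "real (card E) < real s * ((n - real s)\<^sup>2 - 1) / 4"
    proof (cases "card T = 1")
      case True
      then obtain t where t: "T = {t}" by (auto simp: card_1_singleton_iff)
      have "pairs {t} = {}" by (auto elim: pairsE)
      then have "covered {t} = {}" unfolding covered_def by simp
      then have "card (meeting T) \<le> card (link (V - {t}) t)"
        using card_meeting_le[of T] T(1) t by simp
      also have "\<dots> \<le> card (pairs (V - {t}))"
        using finite_V link_subset by (intro card_mono finite_pairs) auto
      also have "\<dots> = (card V - 1) choose 2" using finite_V T(1) t by (simp add: card_pairs)
      finally have "real (card (meeting T)) \<le> real ((card V - 1) choose 2)"
        by (simp only: of_nat_le_iff)
      also have "\<dots> = (n - 1) * (n - 2) / 2"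
        using assms(3) unfolding n_def by (intro choose_two_minus_one_real) simp
      finally have m: "real (card (meeting T)) \<le> (n - 1) * (n - 2) / 2" .
      have "m = 1" using True unfolding m_def by simp
      then have "k \<ge> 2" "k + 1 = real s" "n \<ge> 30 * (k + 2)" using num by argo+
      then have "(n - 1) * (n - 2) / 2 + 3 * k\<^sup>2 * n < real s * ((n - real s)\<^sup>2 - 1) / 4"
        using remainder_estimate_one[of k n] by (simp add: add.commute)
      then show ?thesis using split av m by linarith
    next
      case False
      have "real (card (meeting T)) \<le> m * (n - m)\<^sup>2 / 4 + n"
      proof (cases "card T \<ge> 3")
        case True
        have "card (meeting T) \<le> card T * ((card V - card T)\<^sup>2 div 4)"
          using lt assms(3) by (intro card_meeting_le_quarter(1)[OF T(1) True]) simp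
        then have "real (card (meeting T)) \<le> m * real ((card V - card T)\<^sup>2 div 4)"
          unfolding m_def by (metis of_nat_le_iff of_nat_mult)
        also have "\<dots> \<le> m * ((n - m)\<^sup>2 / 4)"
          using quarter_square_le[of "card V - card T"] num unfolding nm by (intro mult_left_mono) auto
        finally show ?thesis using num by simp
      next
        case small: False
        then consider "card T = 0" | "card T = 2" using False by linarith
        then show ?thesis
        proof cases
          case 1
          then have "meeting T = {}" using fin unfolding meeting_def by auto
          then show ?thesis using num by simp
        next
          case 2
          then obtain a b where ab: "T = {a, b}" "a \<noteq> b" by (auto simp: card_2_iff)
          have "covered T \<subseteq> pairs T" unfolding covered_def by auto
          then have "card (covered T) \<le> 1"
            using card_mono[of "pairs T" "covered T"] fin 2 by (simp add: finite_pairs card_pairs)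
          then have c: "card (covered T) * card V \<le> card V" by simp
          have l: "card (link (V - T) a) + card (link (V - T) b) \<le> 2 * ((card V - card T)\<^sup>2 div 4)"
            using sum_two_links_le[OF T(1), of a b] ab by simp
          have "card (meeting T) \<le> 2 * ((card V - card T)\<^sup>2 div 4) + card V"
          proof -
            have "(\<Sum>t\<in>T. card (link (V - T) t)) = card (link (V - T) a) + card (link (V - T) b)"
              unfolding ab(1) using ab(2) by simp
            then show ?thesis using card_meeting_le[OF T(1)] c l by linarith
          qed
          then have "real (card (meeting T)) \<le> real (2 * ((card V - card T)\<^sup>2 div 4) + card V)"
            by (simp only: of_nat_le_iff)
          then have "real (card (meeting T)) \<le> 2 * real ((card V - card T)\<^sup>2 div 4) + n"
            unfolding n_def by simp
          moreover have "real ((card V - card T)\<^sup>2 div 4) \<le> (n - m)\<^sup>2 / 4"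
            using quarter_square_le[of "card V - card T"] unfolding nm .
          moreover have "m = 2" using 2 unfolding m_def by simp
          ultimately show ?thesis by simp
        qed
      qed
      moreover have "m * (n - m)\<^sup>2 / 4 + n + 3 * k\<^sup>2 * n < (m + k) * ((n - (m + k))\<^sup>2 - 1) / 4"
        using num by (intro remainder_estimate) auto
      ultimately show ?thesis using split av num(3) by simp
    qed
    then have "real (card E) < real (s * ((card V - s)\<^sup>2 div 4))" using rhs by linarith
    then show ?thesis by (simp only: of_nat_less_iff)
  qed
  have full: "avoiding T = {} \<and> meeting T = E" if "card T = s"
  proof -
    have "card (avoiding T) = 0" using T(4) that by simp
    moreover have "finite (avoiding T)" using finite_E unfolding avoiding_def by simp
    ultimately have "avoiding T = {}" by simp
    then show ?thesis unfolding avoiding_def meeting_def by auto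
  qed
  show "card E \<le> s * ((card V - s)\<^sup>2 div 4)"
  proof (cases "card T = s")
    case True
    then show ?thesis using full card_meeting_le_quarter(1)[OF T(1)] s n by auto
  qed (use less T in auto)
  assume eq: "card E = s * ((card V - s)\<^sup>2 div 4)"
  then have cT: "card T = s" using less T(2) by fastforce
  then have "\<exists>A B. A \<union> B = V - T \<and> A \<inter> B = {} \<and> card A = (card V - s) div 2 \<and>
        E = {{t, a, b} | t a b. t \<in> T \<and> a \<in> A \<and> b \<in> B}"
    using card_meeting_le_quarter(2)[OF T(1)] full[OF cT] s n eq by simp
  then obtain A B where AB: "A \<union> B = V - T" "A \<inter> B = {}" "card A = (card V - s) div 2"
        "E = {{t, a, b} | t a b. t \<in> T \<and> a \<in> A \<and> b \<in> B}" by blast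
  then have "T \<union> A \<union> B = V" "T \<inter> A = {}" "T \<inter> B = {}" using T(1) by blast+
  then show "\<exists>T A B. T \<union> A \<union> B = V \<and> T \<inter> A = {} \<and> T \<inter> B = {} \<and> A \<inter> B = {} \<and>
        card T = s \<and> card A = (card V - s) div 2 \<and>
        E = {{t, a, b} | t a b. t \<in> T \<and> a \<in> A \<and> b \<in> B}"
    using AB cT by blast
qed

end

section \<open>Forbidden subgraphs, stars and complete 3-partite 3-graphs\<close>

lemma F5_free_graph_of_free:
  assumes H: "three_graph H" and free: "\<not> contains H F5"
  shows "F5_free_graph (verts H) (edges H)"
proof -
  have edge: "e \<subseteq> verts H \<and> card e = 3" if "e \<in> edges H" for e
    using H that unfolding three_graph_def by blast
  have "{c, d, w} \<notin> edges H"
    if dist: "distinct [a, b, c, d, w]" and e: "{a, b, c} \<in> edges H" "{a, b, d} \<in> edges H" for a b c d w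
  proof
    assume e3: "{c, d, w} \<in> edges H"
    define f where "f i = (if i = 0 then a else if i = 1 then b else if i = 2 then c else if i = 3 then d else w)"
      for i :: nat
    have f: "f 0 = a" "f 1 = b" "f 2 = c" "f 3 = d" "f 4 = w" unfolding f_def by simp_all
    have "{a, b, c} \<subseteq> verts H" "{a, b, d} \<subseteq> verts H" "{c, d, w} \<subseteq> verts H"
      using edge e e3 by blast+
    then have "f ` verts F5 \<subseteq> verts H" unfolding F5_def using f by simp
    moreover have "inj_on f (verts F5)"
      unfolding F5_def using dist f by simp
    moreover have "\<forall>e\<in>edges F5. f ` e \<in> edges H"
      unfolding F5_def using e e3 f by simp
    ultimately show False using free unfolding contains_def by blast
  qed
  moreover have "finite (verts H)" using H unfolding three_graph_def by blast
  ultimately show ?thesis using edge by unfold_locales blast+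
qed

lemma matching_le_of_free:
  assumes H: "three_graph H" and free: "\<not> contains H (matching3 (s + 1))"
  shows "matching_le (edges H) s"
  unfolding matching_le_def
proof (intro allI impI)
  fix M assume M: "M \<subseteq> edges H" "pairwise disjnt M"
  show "card M \<le> s"
  proof (rule ccontr)
    assume "\<not> card M \<le> s"
    then have big: "s + 1 \<le> card M" by simp
    then obtain M' where M': "M' \<subseteq> M" "card M' = s + 1" "finite M'" using obtain_subset_with_card_n by metis
    then obtain h where h: "bij_betw h {0..<s + 1} M'" using ex_bij_betw_nat_finite by metis
    have "\<exists>l :: nat \<Rightarrow> _. e = {l 0, l 1, l 2} \<and> inj_on l {0, 1, 2}" if "e \<in> M" for e
    proof -
      have "card e = 3" using that M H unfolding three_graph_def by auto
      then obtain a b c where abc: "e = {a, b, c}" "a \<noteq> b" "a \<noteq> c" "b \<noteq> c" by (auto simp: card_3_iff)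
      then show ?thesis
        by (intro exI[of _ "\<lambda>i. if i = 0 then a else if i = 1 then b else c"]) (auto simp: inj_on_def)
    qed
    then obtain l :: "_ \<Rightarrow> nat \<Rightarrow> _" where
      l: "\<And>e. e \<in> M \<Longrightarrow> e = {l e 0, l e 1, l e 2} \<and> inj_on (l e) {0, 1, 2}" by metis
    (* Vertex 3 * i + j of the matching goes to the j-th vertex of the i-th edge. *)
    define f where "f i = l (h (i div 3)) (i mod 3)" for i
    have hM: "h i \<in> M" "h i \<in> edges H" if "i < s + 1" for i
    proof -
      have "h i \<in> M'" using h that unfolding bij_betw_def by auto
      then show "h i \<in> M" "h i \<in> edges H" using M M' by blast+
    qed
    have im: "f ` {3 * i, 3 * i + 1, 3 * i + 2} = h i" if "i < s + 1" for i
    proof -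
      have "(3 * i + 1) div 3 = i" "(3 * i + 2) div 3 = i" by simp_all
      moreover have "(3 * i + 1) mod 3 = 1" "(3 * i + 2) mod 3 = 2" by presburger+
      ultimately have "f ` {3 * i, 3 * i + 1, 3 * i + 2} = {l (h i) 0, l (h i) 1, l (h i) 2}"
        unfolding f_def by simp
      then show ?thesis using l[OF hM(1)[OF that]] by metis
    qed
    have lin: "l (h i) j \<in> h i" if "i < s + 1" "j < 3" for i j
    proof -
      have "j = 0 \<or> j = 1 \<or> j = 2" using that(2) by auto
      then have "l (h i) j \<in> {l (h i) 0, l (h i) 1, l (h i) 2}" by auto
      then show ?thesis using l[OF hM(1)[OF that(1)]] by metis
    qed
    have "inj_on f {0..<3 * (s + 1)}"
    proof (rule inj_onI)
      fix i j assume ij: "i \<in> {0..<3 * (s + 1)}" "j \<in> {0..<3 * (s + 1)}" "f i = f j"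
      then have lt: "i div 3 < s + 1" "j div 3 < s + 1" by auto
      have "i mod 3 < 3" "j mod 3 < 3" by simp_all
      then have "f i \<in> h (i div 3)" "f j \<in> h (j div 3)"
        using lin lt unfolding f_def by blast+
      then have "\<not> disjnt (h (i div 3)) (h (j div 3))" using ij(3) unfolding disjnt_def by auto
      then have "h (i div 3) = h (j div 3)"
        using M(2) hM lt unfolding pairwise_def by blast
      then have d: "i div 3 = j div 3"
        using h lt unfolding bij_betw_def inj_on_def by auto
      have "i mod 3 \<in> {0, 1, 2}" "j mod 3 \<in> {0, 1, 2}" by auto
      moreover have "inj_on (l (h (i div 3))) {0, 1, 2}" using l hM lt by blast
      moreover have "l (h (i div 3)) (i mod 3) = l (h (i div 3)) (j mod 3)"
        using ij(3) d unfolding f_def by simp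
      ultimately have "i mod 3 = j mod 3" by (meson inj_onD)
      then show "i = j" using d by (metis div_mult_mod_eq)
    qed
    moreover have "f ` {0..<3 * (s + 1)} \<subseteq> verts H"
    proof
      fix v assume "v \<in> f ` {0..<3 * (s + 1)}"
      then obtain i where i: "v = f i" "i div 3 < s + 1" by auto
      have "v \<in> h (i div 3)" using lin[OF i(2), of "i mod 3"] i unfolding f_def by simp
      then show "v \<in> verts H" using hM(2)[OF i(2)] H unfolding three_graph_def by auto
    qed
    moreover have "\<forall>e\<in>edges (matching3 (s + 1)). f ` e \<in> edges H"
      using im hM unfolding matching3_def by auto
    ultimately have "contains H (matching3 (s + 1))"
      unfolding contains_def by (auto simp: matching3_def)
    then show False using free by simp
  qed
qed

lemma matching3_edge: "i < t \<Longrightarrow> {3 * i, 3 * i + 1, 3 * i + 2} \<in> edges (matching3 t)"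
  unfolding matching3_def by auto

text \<open>
  No vertex lies in all three edges of \<open>F5\<close>.
\<close>

lemma star_F5_free: "\<not> contains (full_star V x) F5"
proof
  assume "contains (full_star V x) F5"
  then obtain f where f: "inj_on f {0, 1, 2, 3, 4::nat}"
    "x \<in> f ` {0, 1, 2}" "x \<in> f ` {0, 1, 3}" "x \<in> f ` {2, 3, 4}"
    unfolding contains_def F5_def full_star_def by auto
  have "f 0 \<noteq> f 2" "f 0 \<noteq> f 3" "f 0 \<noteq> f 4" "f 1 \<noteq> f 2" "f 1 \<noteq> f 3" "f 1 \<noteq> f 4" "f 2 \<noteq> f 3"
    using f(1) by (auto simp: inj_on_def)
  then show False using f by auto
qed

lemma star_matching_free:
  assumes "s \<ge> 1" shows "\<not> contains (full_star V x) (matching3 (s + 1))"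
proof
  assume "contains (full_star V x) (matching3 (s + 1))"
  then obtain f where f: "inj_on f {0..<3 * (s + 1)}"
    "\<And>e. e \<in> edges (matching3 (s + 1)) \<Longrightarrow> f ` e \<in> edges (full_star V x)"
    unfolding contains_def by (auto simp: matching3_def)
  have x: "x \<in> f ` {3 * i, 3 * i + 1, 3 * i + 2}" if "i < s + 1" for i
    using f(2)[OF matching3_edge[OF that]] unfolding full_star_def by simp
  have "0 < s + 1" "1 < s + 1" using assms by simp_all
  note x[OF this(1)] x[OF this(2)]
  then obtain i j where i: "x = f i" "i \<in> {3 * 0, 3 * 0 + 1, 3 * 0 + 2}"
    and j: "x = f j" "j \<in> {3 * 1, 3 * 1 + 1, 3 * 1 + 2}" by (elim imageE)
  have "i \<in> {0..<3 * (s + 1)}" "j \<in> {0..<3 * (s + 1)}" "i \<noteq> j" using i(2) j(2) assms by auto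
  moreover have "f i = f j" using i(1) j(1) by simp
  ultimately show False using f(1) by (meson inj_onD)
qed

lemma star_extremal_candidate:
  assumes "finite V" "x \<in> V"
  shows "three_graph (full_star V x)" "card (edges (full_star V x)) = (card V - 1) choose 2"
  using card_star[OF assms] assms unfolding three_graph_def full_star_def by auto

locale tripartition =
  fixes A B C :: "'a set"
  assumes fin: "finite A" "finite B" "finite C"
    and disj: "A \<inter> B = {}" "A \<inter> C = {}" "B \<inter> C = {}"
begin

lemma three_graph_complete: "three_graph (complete_3partite A B C)"
  unfolding three_graph_def complete_3partite_def
proof (intro conjI ballI)
  show "finite (verts (A \<union> B \<union> C, {{a, b, c} |a b c. a \<in> A \<and> b \<in> B \<and> c \<in> C}))" using fin by simp
  fix e assume "e \<in> edges (A \<union> B \<union> C, {{a, b, c} |a b c. a \<in> A \<and> b \<in> B \<and> c \<in> C})"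
  then obtain a b c where abc: "e = {a, b, c}" "a \<in> A" "b \<in> B" "c \<in> C" by auto
  then have "a \<noteq> b" "a \<noteq> c" "b \<noteq> c" using disj by auto
  then show "card e = 3" "e \<subseteq> verts (A \<union> B \<union> C, {{a, b, c} |a b c. a \<in> A \<and> b \<in> B \<and> c \<in> C})"
    using abc by auto
qed

lemma card_edges_complete: "card (edges (complete_3partite A B C)) = card A * (card B * card C)"
proof -
  have "edges (complete_3partite A B C) = (\<lambda>(a, b, c). {a, b, c}) ` (A \<times> B \<times> C)"
    unfolding complete_3partite_def by auto
  moreover have "inj_on (\<lambda>(a, b, c). {a, b, c}) (A \<times> B \<times> C)"
  proof (rule inj_onI, clarsimp)
    fix a b c a' b' c'
    assume m: "a \<in> A" "b \<in> B" "c \<in> C" "a' \<in> A" "b' \<in> B" "c' \<in> C" and e: "{a, b, c} = {a', b', c'}"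
    have "a \<in> {a', b', c'}" "b \<in> {a', b', c'}" "c \<in> {a', b', c'}" using e by blast+
    then show "a = a' \<and> b = b' \<and> c = c'" using m disj by blast
  qed
  ultimately show ?thesis by (simp add: card_image card_cartesian_product)
qed

text \<open>
  Colour the vertices by their part. The edges \<open>abc\<close> and \<open>abd\<close> give \<open>c\<close> and \<open>d\<close> the same colour, but
  they lie in the common edge \<open>cde\<close>.
\<close>

lemma complete_F5_free: "\<not> contains (complete_3partite A B C) F5"
proof
  assume "contains (complete_3partite A B C) F5"
  then obtain f where f: "inj_on f (verts F5)" "\<forall>e\<in>edges F5. f ` e \<in> edges (complete_3partite A B C)"
    unfolding contains_def by auto
  define col where "col v = (if v \<in> A then 0 else if v \<in> B then 1 else 2::nat)" for v
  have col: "{col u, col v, col w} = {0, 1, 2}" if "{u, v, w} \<in> edges (complete_3partite A B C)" for u v w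
  proof -
    from that obtain a b c where abc: "{u, v, w} = {a, b, c}" "a \<in> A" "b \<in> B" "c \<in> C"
      unfolding complete_3partite_def by auto
    have "col a = 0" "col b = 1" "col c = 2" using abc(2-4) disj unfolding col_def by auto
    moreover have "{col u, col v, col w} = col ` {u, v, w}" by simp
    ultimately show ?thesis unfolding abc(1) by simp
  qed
  have "{f 0, f 1, f 2} \<in> edges (complete_3partite A B C)" "{f 0, f 1, f 3} \<in> edges (complete_3partite A B C)"
    "{f 2, f 3, f 4} \<in> edges (complete_3partite A B C)"
    using f(2) unfolding F5_def by simp_all
  from this[THEN col]
  have c: "{col (f 0), col (f 1), col (f 2)} = {0, 1, 2}" "{col (f 0), col (f 1), col (f 3)} = {0, 1, 2}"
    "{col (f 2), col (f 3), col (f 4)} = {0, 1, 2}" .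
  have "card {col (f 0), col (f 1), col (f 2)} = 3" "card {col (f 0), col (f 1), col (f 3)} = 3"
    "card {col (f 2), col (f 3), col (f 4)} = 3" unfolding c by simp_all
  from this[THEN distinct_of_card_triple]
  have "col (f 2) \<noteq> col (f 0)" "col (f 2) \<noteq> col (f 1)" "col (f 3) \<noteq> col (f 0)" "col (f 3) \<noteq> col (f 1)"
    "col (f 0) \<noteq> col (f 1)" "col (f 2) \<noteq> col (f 3)" by auto
  moreover have "col v < 3" for v unfolding col_def by auto
  note this[of "f 0"] this[of "f 1"] this[of "f 2"] this[of "f 3"]
  ultimately show False by arith
qed

text \<open>
  Disjoint edges use different vertices of \<open>A\<close>.
\<close>

lemma complete_matching_free:
  assumes "card A \<le> s"
  shows "\<not> contains (complete_3partite A B C) (matching3 (s + 1))"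
proof
  assume "contains (complete_3partite A B C) (matching3 (s + 1))"
  then obtain f where f: "inj_on f {0..<3 * (s + 1)}"
    "\<And>e. e \<in> edges (matching3 (s + 1)) \<Longrightarrow> f ` e \<in> edges (complete_3partite A B C)"
    unfolding contains_def by (auto simp: matching3_def)
  have "\<exists>j. j div 3 = i \<and> f j \<in> A" if "i < s + 1" for i
  proof -
    have "{3 * i, 3 * i + 1, 3 * i + 2} \<in> edges (matching3 (s + 1))"
      using that by (rule matching3_edge)
    then have "f ` {3 * i, 3 * i + 1, 3 * i + 2} \<in> edges (complete_3partite A B C)" by (rule f(2))
    then obtain a where "a \<in> A" "a \<in> f ` {3 * i, 3 * i + 1, 3 * i + 2}"
      unfolding complete_3partite_def by auto
    then obtain j where "j \<in> {3 * i, 3 * i + 1, 3 * i + 2}" "f j \<in> A" by auto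
    then show ?thesis by (intro exI[of _ j]) auto
  qed
  then obtain j where j: "\<And>i. i < s + 1 \<Longrightarrow> j i div 3 = i \<and> f (j i) \<in> A" by metis
  have jr: "j i \<in> {0..<3 * (s + 1)}" if "i < s + 1" for i
  proof -
    have "j i div 3 < s + 1" using j[OF that] that by simp
    then show ?thesis by auto
  qed
  have "inj_on (\<lambda>i. f (j i)) {..<s + 1}"
  proof (rule inj_onI)
    fix i i' assume i: "i \<in> {..<s + 1}" "i' \<in> {..<s + 1}" "f (j i) = f (j i')"
    then have "j i = j i'" using f(1) jr by (meson inj_onD lessThan_iff)
    then show "i = i'" using j i by (metis lessThan_iff)
  qed
  moreover have "(\<lambda>i. f (j i)) ` {..<s + 1} \<subseteq> A" using j by auto
  ultimately have "card {..<s + 1} \<le> card A" using fin by (meson card_inj_on_le)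
  then show False using assms by simp
qed

end

lemma complete_3partite_isomorphic:
  assumes P: "tripartition A B C" and Q: "tripartition A' B' C'"
    and c: "card A = card A'" "card B = card B'" "card C = card C'"
  shows "isomorphic (complete_3partite A B C) (complete_3partite A' B' C')"
proof -
  note P' = P[unfolded tripartition_def] and Q' = Q[unfolded tripartition_def]
  obtain g1 g2 g3 where g: "bij_betw g1 A A'" "bij_betw g2 B B'" "bij_betw g3 C C'"
    using P' Q' c by (meson finite_same_card_bij)
  define f where "f v = (if v \<in> A then g1 v else if v \<in> B then g2 v else g3 v)" for v
  have fe: "f v = g1 v" if "v \<in> A" for v using that unfolding f_def by simp
  have fe2: "f v = g2 v" if "v \<in> B" for v using that P' unfolding f_def by auto
  have fe3: "f v = g3 v" if "v \<in> C" for v using that P' unfolding f_def by auto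
  have bij: "bij_betw f A A'" "bij_betw f B B'" "bij_betw f C C'"
    using g bij_betw_cong[of A f g1] bij_betw_cong[of B f g2] bij_betw_cong[of C f g3] fe fe2 fe3 by simp_all
  have "bij_betw f (A \<union> B) (A' \<union> B')" using Q' by (intro bij_betw_combine bij) auto
  then have b: "bij_betw f (A \<union> B \<union> C) (A' \<union> B' \<union> C')"
    using Q' by (intro bij_betw_combine[OF _ bij(3)]) auto
  have im: "f ` A = A'" "f ` B = B'" "f ` C = C'" using bij unfolding bij_betw_def by auto
  have "(\<lambda>e. f ` e) ` {{a, b, c} |a b c. a \<in> A \<and> b \<in> B \<and> c \<in> C}
    = {{a, b, c} |a b c. a \<in> A' \<and> b \<in> B' \<and> c \<in> C'}" (is "?L = ?R")
  proof
    show "?L \<subseteq> ?R"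
    proof
      fix e assume "e \<in> ?L"
      then obtain a b c where "e = f ` {a, b, c}" "a \<in> A" "b \<in> B" "c \<in> C" by auto
      then have "e = {f a, f b, f c}" "f a \<in> A'" "f b \<in> B'" "f c \<in> C'" using im by auto
      then show "e \<in> ?R" by blast
    qed
    show "?R \<subseteq> ?L"
    proof
      fix e assume "e \<in> ?R"
      then obtain a b c where e: "e = {a, b, c}" "a \<in> A'" "b \<in> B'" "c \<in> C'" by auto
      then obtain x y z where "a = f x" "b = f y" "c = f z" "x \<in> A" "y \<in> B" "z \<in> C"
        unfolding im[symmetric] by blast
      then have "e = f ` {x, y, z}" "{x, y, z} \<in> {{a, b, c} |a b c. a \<in> A \<and> b \<in> B \<and> c \<in> C}"
        using e by auto
      then show "e \<in> ?L" by blast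
    qed
  qed
  then show ?thesis using b unfolding isomorphic_def complete_3partite_def by auto
qed

lemma H3_tripartition:
  fixes s n :: nat
  shows "tripartition {1..s} {s + 1..s + (n - s) div 2} {s + (n - s) div 2 + 1..n}"
  by unfold_locales auto

lemma H3_card:
  assumes "s \<le> n"
  shows "card (verts (H3 n s)) = n" "card (edges (H3 n s)) = s * ((n - s)\<^sup>2 div 4)"
proof -
  have "n - s - (n - s) div 2 = n - (s + (n - s) div 2)" by simp
  then show "card (edges (H3 n s)) = s * ((n - s)\<^sup>2 div 4)"
    unfolding H3_def tripartition.card_edges_complete[OF H3_tripartition] quarter_square_eq by simp
  have "{1..s} \<union> {s + 1..s + (n - s) div 2} \<union> {s + (n - s) div 2 + 1..n} = {1..n}"
    using assms by auto
  then show "card (verts (H3 n s)) = n" unfolding H3_def complete_3partite_def by simp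
qed

lemma contains_of_isomorphic:
  assumes "isomorphic G H" "contains G F"
  shows "contains H F"
proof -
  obtain g where g: "bij_betw g (verts G) (verts H)" "(\<lambda>e. g ` e) ` edges G = edges H"
    using assms(1) unfolding isomorphic_def by blast
  obtain f where f: "inj_on f (verts F)" "f ` verts F \<subseteq> verts G" "\<forall>e\<in>edges F. f ` e \<in> edges G"
    using assms(2) unfolding contains_def by blast
  have "inj_on (g \<circ> f) (verts F)"
    using f g(1) by (meson bij_betw_def comp_inj_on inj_on_subset)
  moreover have "(g \<circ> f) ` verts F \<subseteq> verts H" using f g(1) unfolding bij_betw_def by auto
  moreover have "\<forall>e\<in>edges F. (g \<circ> f) ` e \<in> edges H"
  proof
    fix e assume "e \<in> edges F"
    then have "g ` f ` e \<in> edges H" using f(3) g(2) by blast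
    then show "(g \<circ> f) ` e \<in> edges H" by (simp only: image_comp)
  qed
  ultimately show ?thesis unfolding contains_def by blast
qed

lemma card_edges_of_isomorphic:
  assumes "isomorphic G H" "three_graph G"
  shows "card (edges G) = card (edges H)"
proof -
  obtain g where g: "bij_betw g (verts G) (verts H)" "(\<lambda>e. g ` e) ` edges G = edges H"
    using assms(1) unfolding isomorphic_def by blast
  have "inj_on (\<lambda>e. g ` e) (edges G)"
    using g(1) assms(2) unfolding bij_betw_def three_graph_def
    by (intro inj_onI) (meson inj_on_image_eq_iff)
  then show ?thesis using g(2) card_image by fastforce
qed

lemma ex3_eqI:
  fixes H :: "nat hypergraph"
  assumes H: "three_graph H" "card (verts H) = n" "free_of \<F> H" "card (edges H) = m"
    and le: "\<And>H :: nat hypergraph. three_graph H \<Longrightarrow> card (verts H) = n \<Longrightarrow> free_of \<F> H \<Longrightarrow> card (edges H) \<le> m"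
  shows "ex3 n \<F> = m"
  unfolding ex3_def
proof (rule Max_eqI)
  show "finite {card (edges H) | H :: nat hypergraph. three_graph H \<and> card (verts H) = n \<and> free_of \<F> H}"
    using le by (intro finite_subset[OF _ finite_atMost[of m]]) auto
  show "m \<in> {card (edges H) | H :: nat hypergraph. three_graph H \<and> card (verts H) = n \<and> free_of \<F> H}"
    using H by blast
qed (use le in blast)

lemma free_of_pair_iff: "free_of {F, F'} H \<longleftrightarrow> \<not> contains H F \<and> \<not> contains H F'"
  unfolding free_of_def by simp

lemma edges_le_star:
  fixes H :: "'a hypergraph"
  assumes s: "s = 1 \<or> s = 2" and n: "n \<ge> 30 * (s + 1)"
    and H: "three_graph H" "card (verts H) = n" "free_of {F5, matching3 (s + 1)} H"
  shows "card (edges H) \<le> (n - 1) choose 2"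
    and "card (edges H) = (n - 1) choose 2 \<Longrightarrow> \<exists>x\<in>verts H. H = full_star (verts H) x"
proof -
  interpret F5_free_graph "verts H" "edges H"
    using H by (intro F5_free_graph_of_free) (auto simp: free_of_pair_iff)
  have "matching_le (edges H) s"
    using H by (intro matching_le_of_free) (auto simp: free_of_pair_iff)
  note b = card_le_star[OF s this, unfolded H(2), OF n]
  show "card (edges H) \<le> (n - 1) choose 2" using b by blast
  assume "card (edges H) = (n - 1) choose 2"
  from mp[OF conjunct2[OF b] this] obtain x
    where x: "x \<in> verts H" "edges H = {e. e \<subseteq> verts H \<and> card e = 3 \<and> x \<in> e}" by (rule bexE)
  have "H = full_star (verts H) x" unfolding full_star_def by (rule prod_eqI) (simp_all add: x(2))
  then show "\<exists>x\<in>verts H. H = full_star (verts H) x" using x(1) by (rule bexI)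
qed

lemma edges_le_tripartite:
  fixes H :: "'a hypergraph"
  assumes s: "s \<ge> 3" and n: "n \<ge> 30 * (s + 1)"
    and H: "three_graph H" "card (verts H) = n" "free_of {F5, matching3 (s + 1)} H"
  shows "card (edges H) \<le> s * ((n - s)\<^sup>2 div 4)"
    and "card (edges H) = s * ((n - s)\<^sup>2 div 4) \<Longrightarrow> isomorphic H (H3 n s)"
proof -
  interpret F5_free_graph "verts H" "edges H"
    using H by (intro F5_free_graph_of_free) (auto simp: free_of_pair_iff)
  have "matching_le (edges H) s"
    using H by (intro matching_le_of_free) (auto simp: free_of_pair_iff)
  note b = card_le_tripartite[OF s this, unfolded H(2), OF n]
  show "card (edges H) \<le> s * ((n - s)\<^sup>2 div 4)" by (rule b(1))
  assume "card (edges H) = s * ((n - s)\<^sup>2 div 4)"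
  from b(2)[OF this] obtain T A B where TAB: "T \<union> A \<union> B = verts H"
    "T \<inter> A = {}" "T \<inter> B = {}" "A \<inter> B = {}" "card T = s" "card A = (n - s) div 2"
    "edges H = {{t, a, b} | t a b. t \<in> T \<and> a \<in> A \<and> b \<in> B}" by (elim exE conjE)
  have fin: "finite (T \<union> A \<union> B)" using finite_V TAB(1) by simp
  then have tri: "tripartition T A B" using TAB(2-4) by unfold_locales auto
  have "n = card (T \<union> A) + card B"
    using H(2) fin TAB(2-4) card_Un_disjoint[of "T \<union> A" B] unfolding TAB(1)[symmetric]
    by (simp add: Int_Un_distrib2)
  also have "card (T \<union> A) = card T + card A" using fin TAB(2) by (simp add: card_Un_disjoint)
  finally have "card B = n - (s + (n - s) div 2)" using TAB(5,6) by simp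
  then have "isomorphic (complete_3partite T A B) (H3 n s)"
    unfolding H3_def using TAB(5,6)
    by (intro complete_3partite_isomorphic[OF tri H3_tripartition]) simp_all
  moreover have "H = complete_3partite T A B"
    unfolding complete_3partite_def by (rule prod_eqI) (simp_all add: TAB(1,7))
  ultimately show "isomorphic H (H3 n s)" by simp
qed

section \<open>The extremal number and the extremal 3-graphs\<close>

theorem theorem1p6:
  fixes s n :: nat
  assumes "s \<ge> 1" and "n \<ge> 30 * (s + 1)"
  shows "ex3 n {F5, matching3 (s + 1)} =
           (if s = 1 \<or> s = 2 then (n - 1) choose 2 else s * ((n - s)\<^sup>2 div 4))
       \<and> (\<forall>H :: 'a hypergraph. three_graph H \<and> card (verts H) = n \<longrightarrow>
            (s = 1 \<or> s = 2 \<longrightarrow>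
               (extremal n {F5, matching3 (s + 1)} H \<longleftrightarrow>
                 (\<exists>x\<in>verts H. H = full_star (verts H) x)))
          \<and> (s \<ge> 3 \<longrightarrow>
               (extremal n {F5, matching3 (s + 1)} H \<longleftrightarrow> isomorphic H (H3 n s))))"
proof (cases "s = 1 \<or> s = 2")
  case True
  let ?F = "{F5, matching3 (s + 1)}"
  have ex: "ex3 n ?F = (n - 1) choose 2"
  proof (rule ex3_eqI)
    have "n > 0" using assms by simp
    then show "three_graph (full_star {0..<n} 0)"
      "card (edges (full_star {0..<n} 0)) = (n - 1) choose 2"
      using star_extremal_candidate[of "{0..<n}" 0] by simp_all
    show "card (verts (full_star {0..<n} 0)) = n" unfolding full_star_def by simp
    show "free_of ?F (full_star {0..<n} 0)"
      by (simp only: free_of_pair_iff star_F5_free star_matching_free[OF assms(1)] simp_thms)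
  qed (rule edges_le_star(1)[OF True assms(2)])
  have "extremal n ?F H \<longleftrightarrow> (\<exists>x\<in>verts H. H = full_star (verts H) x)"
    if H: "three_graph H" "card (verts H) = n" for H :: "'a hypergraph"
  proof
    assume "extremal n ?F H"
    then show "\<exists>x\<in>verts H. H = full_star (verts H) x"
      unfolding extremal_def ex by (elim conjE) (rule edges_le_star(2)[OF True assms(2)])
  next
    assume "\<exists>x\<in>verts H. H = full_star (verts H) x"
    then obtain x where x: "x \<in> verts H" "H = full_star (verts H) x" by blast
    have "finite (verts H)" using H unfolding three_graph_def by simp
    then have "card (edges H) = (n - 1) choose 2" using star_extremal_candidate(2) x H by metis
    moreover have "free_of ?F H"
      by (subst x(2)) (simp only: free_of_pair_iff star_F5_free star_matching_free[OF assms(1)] simp_thms)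
    ultimately show "extremal n ?F H" using H ex unfolding extremal_def by simp
  qed
  then show ?thesis using ex True by auto
next
  case False
  then have s: "s \<ge> 3" using assms(1) by auto
  let ?F = "{F5, matching3 (s + 1)}"
  have sn: "s \<le> n" using assms by simp
  have free: "\<not> contains (H3 n s) F5" "\<not> contains (H3 n s) (matching3 (s + 1))"
    unfolding H3_def
    by (rule tripartition.complete_F5_free[OF H3_tripartition],
        rule tripartition.complete_matching_free[OF H3_tripartition]) simp
  have ex: "ex3 n ?F = s * ((n - s)\<^sup>2 div 4)"
  proof (rule ex3_eqI)
    show "three_graph (H3 n s)"
      unfolding H3_def by (rule tripartition.three_graph_complete[OF H3_tripartition])
    show "free_of ?F (H3 n s)" using free by (simp add: free_of_pair_iff)
  qed (rule H3_card[OF sn] edges_le_tripartite(1)[OF s assms(2)]; assumption)+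
  have "extremal n ?F H \<longleftrightarrow> isomorphic H (H3 n s)"
    if H: "three_graph H" "card (verts H) = n" for H :: "'a hypergraph"
  proof
    assume "extremal n ?F H"
    then show "isomorphic H (H3 n s)"
      unfolding extremal_def ex by (elim conjE) (rule edges_le_tripartite(2)[OF s assms(2)])
  next
    assume iso: "isomorphic H (H3 n s)"
    then have "card (edges H) = s * ((n - s)\<^sup>2 div 4)"
      using card_edges_of_isomorphic[OF iso H(1)] H3_card(2)[OF sn] by simp
    moreover have "free_of ?F H"
      using free contains_of_isomorphic[OF iso, of F5]
        contains_of_isomorphic[OF iso, of "matching3 (s + 1)"]
      unfolding free_of_pair_iff by blast
    ultimately show "extremal n ?F H" using H ex unfolding extremal_def by simp
  qed
  then show ?thesis using ex False s by auto
qed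

end
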